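(* For every integer $L \ge 1$, $$2N_{Z,{\rm sq},{\rm PF},L}-N_{Z,{\rm tri},{\rm PF},L} = \begin{cases} N_{Z,{\rm sqtri},{\rm FP},\frac{L}{2}} & \text{for even } L,\\[1mm] \tfrac{1}{2}\,N_{Z,{\rm sqtri},{\rm FP},\frac{L+1}{2}} & \text{for odd } L,\end{cases}$$ where $N_{Z,{\rm sqtri},{\rm FP},n} = \binom{2n}{n}$ for every integer $n \ge 1$.
   Context: A set partition of $\{1,2,\ldots,L\}$ is non-crossing if there are no $a<b<c<d$ such that $a,c$ belong to one block and $b,d$ belong to a different block. Regard $1,\ldots,L$ as the vertices, in cyclic order, of a circuit with $L$ vertices. The rotation $i \mapsto i+1 \pmod L$ and the reflection $i \mapsto L+1-i$ act on the set of non-crossing partitions of $\{1,\ldots,L\}$. $N_{Z,{\rm tri},{\rm PF},L}$ is the number of equivalence classes (orbits) of non-crossing partitions of $\{1,\ldots,L\}$ under the group generated by the rotation. (This is the dimension of the translation-invariant transfer matrix, in the Fortuin-Kasteleyn representation, of the Potts model on a triangular-lattice strip of width $L$ with periodic transverse and free longitudinal boundary conditions.) $N_{Z,{\rm sq},{\rm PF},L}$ is the number of equivalence classes (orbits) of non-crossing partitions of $\{1,\ldots,L\}$ under the group generated by the rotation and the reflection. (This is the corresponding dimension for the square-lattice strip.) *)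

theory Defs
  imports
    Complex_Main
    "HOL-Library.Disjoint_Sets"
    "HOL-Algebra.Generated_Groups"
    "HOL-Algebra.Group_Action"
begin

definition noncrossing :: "nat set set \<Rightarrow> bool" where
  "noncrossing P \<longleftrightarrow>
     \<not> (\<exists>a b c d. \<exists>B\<in>P. \<exists>B'\<in>P. a < b \<and> b < c \<and> c < d \<and>
          B \<noteq> B' \<and> a \<in> B \<and> c \<in> B \<and> b \<in> B' \<and> d \<in> B')"

definition NC :: "nat \<Rightarrow> nat set set set" where
  "NC L = {P. partition_on {1..L} P \<and> noncrossing P}"

(* i mod L + 1 is the representative of i + 1 modulo L in {1..L}.  Both maps are restricted
   to {1..L} because the elements of BijGroup are extensional functions. *)

definition rotation :: "nat \<Rightarrow> nat \<Rightarrow> nat" where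
  "rotation L = (\<lambda>i\<in>{1..L}. i mod L + 1)"

definition reflection :: "nat \<Rightarrow> nat \<Rightarrow> nat" where
  "reflection L = (\<lambda>i\<in>{1..L}. L + 1 - i)"

definition rotation_group :: "nat \<Rightarrow> (nat \<Rightarrow> nat) monoid" where
  "rotation_group L = subgroup_generated (BijGroup {1..L}) {rotation L}"

definition rotation_reflection_group :: "nat \<Rightarrow> (nat \<Rightarrow> nat) monoid" where
  "rotation_reflection_group L =
     subgroup_generated (BijGroup {1..L}) {rotation L, reflection L}"

definition NC_act :: "nat \<Rightarrow> (nat \<Rightarrow> nat) \<Rightarrow> nat set set \<Rightarrow> nat set set" where
  "NC_act L g = (\<lambda>P\<in>NC L. (\<lambda>B. g ` B) ` P)"

definition N_Z_tri_PF :: "nat \<Rightarrow> nat" where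
  "N_Z_tri_PF L = card (orbits (rotation_group L) (NC L) (NC_act L))"

definition N_Z_sq_PF :: "nat \<Rightarrow> nat" where
  "N_Z_sq_PF L = card (orbits (rotation_reflection_group L) (NC L) (NC_act L))"

definition N_Z_sqtri_FP :: "nat \<Rightarrow> nat" where
  "N_Z_sqtri_FP n = (2 * n) choose n"

(* subgroup_generated discards generators outside the carrier, so these two facts are needed
   for the groups above to be the intended ones. *)

lemma rotation_in_Bij: "rotation L \<in> carrier (BijGroup {1..L})"
proof -
  have inj: "inj_on (rotation L) {1..L}"
  proof (rule inj_onI)
    fix x y assume *: "x \<in> {1..L}" "y \<in> {1..L}" "rotation L x = rotation L y"
    then have "x mod L = y mod L" by (simp add: rotation_def)
    with * show "x = y"
      by (cases "x = L"; cases "y = L") auto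
  qed
  have "rotation L i \<in> {1..L}" if "i \<in> {1..L}" for i
    using that mod_less_divisor[of L i] by (auto simp: rotation_def Suc_le_eq)
  then have "rotation L ` {1..L} = {1..L}"
    by (intro endo_inj_surj inj) auto
  with inj show ?thesis
    by (auto simp: BijGroup_def Bij_def bij_betw_def rotation_def)
qed

lemma reflection_in_Bij: "reflection L \<in> carrier (BijGroup {1..L})"
proof -
  have "bij_betw (reflection L) {1..L} {1..L}"
    by (rule bij_betw_byWitness[where f' = "reflection L"]) (auto simp: reflection_def)
  then show ?thesis
    by (auto simp: BijGroup_def Bij_def reflection_def)
qed

end

theory Submission
  imports Defs
begin

text \<open>
  Weighting each partition by the reciprocal of its orbit size turns twice the number of
  dihedral orbits minus the number of rotation orbits into the average, over the \<open>L\<close> reflections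
  \<open>rotation^k \<circ> reflection\<close>, of the number of non-crossing partitions that the reflection fixes;
  no distinctness of the group elements is needed, so the degenerate cases \<open>L \<le> 2\<close> are included.
  A partition fixed by a reflection is determined by its restriction to one half \<open>{1..m}\<close> of the
  circuit and by the set of outer blocks of that half that are joined to their mirror images;
  blocks containing a point of the axis are always joined. So one needs the sum of
  \<open>2^(outer - e)\<close> over non-crossing partitions of \<open>{1..m}\<close>, where \<open>outer\<close> is the number of outer
  blocks and \<open>e\<close> the number of those meeting the axis. Appending a point to a partition with
  \<open>k\<close> outer blocks yields exactly one partition with \<open>j\<close> outer blocks for each \<open>j = 1, \<dots>, k + 1\<close>,
  and iterating this rule on the weight \<open>2^k\<close> produces sums of consecutive binomial coefficients.
\<close>

section \<open>Counting orbits of a dihedral action\<close>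

text \<open>A class of size s contributes s summands equal to 1/s, hence 1 in total. The classes are
  given by a map \<open>D\<close> constant on each class, so that rotation orbits and dihedral
  orbits are both covered.\<close>

lemma card_classes:
  fixes D :: "'a \<Rightarrow> 'a set"
  assumes X: "finite X" and sub: "\<And>x. x \<in> X \<Longrightarrow> D x \<subseteq> X" and refl: "\<And>x. x \<in> X \<Longrightarrow> x \<in> D x"
    and eq: "\<And>x y. x \<in> X \<Longrightarrow> y \<in> D x \<Longrightarrow> D y = D x"
  shows "real (card (D ` X)) = (\<Sum>x\<in>X. 1 / real (card (D x)))"
proof -
  have "(\<Sum>x\<in>X. 1 / real (card (D x))) =
      (\<Sum>c\<in>D ` X. \<Sum>x\<in>{x. x \<in> X \<and> D x = c}. 1 / real (card (D x)))"
    by (rule sum.image_gen[OF X])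
  also have "\<dots> = (\<Sum>c\<in>D ` X. 1)"
  proof (rule sum.cong)
    fix c assume "c \<in> D ` X"
    then obtain x where x: "x \<in> X" "c = D x" by auto
    have "{y. y \<in> X \<and> D y = c} = c"
      using x sub refl eq by blast
    moreover have "finite c" "c \<noteq> {}"
      using x sub refl finite_subset[OF _ X] by blast+
    ultimately show "(\<Sum>y\<in>{y. y \<in> X \<and> D y = c}. 1 / real (card (D y))) = 1"
      using eq x by (simp cong: sum.cong add: card_gt_0_iff)
  qed simp
  finally show ?thesis by simp
qed

text \<open>The relations of the dihedral group of order 2L, with the conjugation relation in the
  inverse-free form RTR = T. They serve twice: for the points of the circuit and for the
  non-crossing partitions.\<close>

locale dihedral_action =
  fixes X :: "'a set" and R T :: "'a \<Rightarrow> 'a" and L :: nat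
  assumes fin: "finite X" and L_pos: "L > 0"
    and R_closed: "x \<in> X \<Longrightarrow> R x \<in> X" and T_closed: "x \<in> X \<Longrightarrow> T x \<in> X"
    and R_period: "x \<in> X \<Longrightarrow> (R ^^ L) x = x" and T_invol: "x \<in> X \<Longrightarrow> T (T x) = x"
    and RTR: "x \<in> X \<Longrightarrow> R (T (R x)) = T x"
begin

definition rot_orbit :: "'a \<Rightarrow> 'a set" where
  "rot_orbit x = range (\<lambda>k. (R ^^ k) x)"

definition full_orbit :: "'a \<Rightarrow> 'a set" where
  "full_orbit x = rot_orbit x \<union> rot_orbit (T x)"

lemma Rpow_closed: "x \<in> X \<Longrightarrow> (R ^^ k) x \<in> X"
  by (induction k) (auto intro: R_closed)

lemma Rpow_Rpow: "(R ^^ j) ((R ^^ k) x) = (R ^^ (j + k)) x"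
  by (simp add: funpow_add)

lemma Rpow_mult: "x \<in> X \<Longrightarrow> (R ^^ (L * k)) x = x"
  by (induction k) (auto simp: funpow_add R_period)

lemma Rpow_mod: "x \<in> X \<Longrightarrow> (R ^^ (k mod L)) x = (R ^^ k) x"
proof -
  assume "x \<in> X"
  have "(R ^^ k) x = (R ^^ (k mod L + L * (k div L))) x" by simp
  also have "\<dots> = (R ^^ (k mod L)) x"
    using \<open>x \<in> X\<close> by (simp only: funpow_add o_apply Rpow_mult)
  finally show ?thesis by simp
qed

text \<open>\<open>R ^^ (L * k - k)\<close> stands in for the power with exponent -k; the natural
  subtraction does not truncate because L is positive.\<close>

lemma Rpow_inverse: "x \<in> X \<Longrightarrow> (R ^^ (L * k - k)) ((R ^^ k) x) = x"
proof -
  assume "x \<in> X"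
  have "L * k - k + k = L * k" using L_pos by (cases L) auto
  then have "(R ^^ (L * k - k)) ((R ^^ k) x) = (R ^^ (L * k)) x"
    by (metis comp_apply funpow_add)
  then show ?thesis using \<open>x \<in> X\<close> by (simp add: Rpow_mult)
qed

lemma R_inj: "inj_on R X"
proof (rule inj_onI)
  fix x y assume "x \<in> X" "y \<in> X" "R x = R y"
  then show "x = y" using Rpow_inverse[of x 1] Rpow_inverse[of y 1] by simp
qed

lemma Rpow_T_Rpow: "x \<in> X \<Longrightarrow> (R ^^ k) (T ((R ^^ k) x)) = T x"
proof (induction k arbitrary: x)
  case (Suc k)
  have "(R ^^ Suc k) (T ((R ^^ Suc k) x)) = R ((R ^^ k) (T ((R ^^ k) (R x))))"
    by (simp add: funpow_swap1)
  with Suc show ?case by (simp add: R_closed RTR)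
qed simp

lemma rot_orbit_bounded: "x \<in> X \<Longrightarrow> rot_orbit x = (\<lambda>k. (R ^^ k) x) ` {..<L}"
  unfolding rot_orbit_def 
proof (intro equalityI subsetI)
  fix y assume "x \<in> X" "y \<in> range (\<lambda>k. (R ^^ k) x)"
  then obtain k where "y = (R ^^ (k mod L)) x" by (auto simp: Rpow_mod)
  then show "y \<in> (\<lambda>k. (R ^^ k) x) ` {..<L}" using L_pos by simp
qed auto

lemma rot_orbit_sub: "x \<in> X \<Longrightarrow> rot_orbit x \<subseteq> X"
  by (auto simp: rot_orbit_def Rpow_closed)

lemma rot_orbit_self: "x \<in> rot_orbit x"
  unfolding rot_orbit_def by (rule range_eqI[of _ _ 0]) simp

lemma rot_orbit_step: "y \<in> rot_orbit x \<Longrightarrow> rot_orbit y \<subseteq> rot_orbit x"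
  by (auto simp: rot_orbit_def Rpow_Rpow)

lemma rot_orbit_sym: "x \<in> X \<Longrightarrow> y \<in> rot_orbit x \<Longrightarrow> x \<in> rot_orbit y"
  unfolding rot_orbit_def
proof (elim rangeE)
  fix k assume "x \<in> X" and y: "y = (R ^^ k) x"
  then have "x = (R ^^ (L * k - k)) y" by (simp only: Rpow_inverse)
  then show "x \<in> range (\<lambda>k. (R ^^ k) y)" by blast
qed

lemma rot_orbit_eq: "x \<in> X \<Longrightarrow> y \<in> rot_orbit x \<Longrightarrow> rot_orbit y = rot_orbit x"
  by (meson rot_orbit_step rot_orbit_sym subset_antisym)

lemma T_Rpow: "x \<in> X \<Longrightarrow> T ((R ^^ k) x) = (R ^^ (L * k - k)) (T x)"
proof -
  assume x: "x \<in> X"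
  have "T ((R ^^ k) x) = (R ^^ (L * k - k)) ((R ^^ k) (T ((R ^^ k) x)))"
    using x by (simp only: Rpow_inverse Rpow_closed T_closed)
  with x show ?thesis by (simp only: Rpow_T_Rpow)
qed

lemma T_rot_orbit: "x \<in> X \<Longrightarrow> y \<in> rot_orbit x \<Longrightarrow> T y \<in> rot_orbit (T x)"
  unfolding rot_orbit_def by (auto simp: T_Rpow)

lemma full_orbit_eq:
  assumes "x \<in> X" "y \<in> full_orbit x" shows "full_orbit y = full_orbit x"
proof (cases "y \<in> rot_orbit x")
  case True
  show ?thesis
    unfolding full_orbit_def rot_orbit_eq[OF assms(1) True]
      rot_orbit_eq[OF T_closed[OF assms(1)] T_rot_orbit[OF assms(1) True]] ..
next
  case False
  then have y: "y \<in> rot_orbit (T x)" using assms by (simp add: full_orbit_def)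
  have "T y \<in> rot_orbit x"
    using T_rot_orbit[OF T_closed[OF assms(1)] y] by (simp add: T_invol assms(1))
  from rot_orbit_eq[OF assms(1) this] show ?thesis
    unfolding full_orbit_def rot_orbit_eq[OF T_closed[OF assms(1)] y] by auto
qed

text \<open>Orbit-stabilizer for the cyclic group of order L, counting exponents below L rather than
  distinct maps. The fibres of k \<mapsto> R^k x over the orbit all have the same size.\<close>

lemma card_stabilizer:
  assumes x: "x \<in> X" and y: "y \<in> rot_orbit x"
  shows "card {k. k < L \<and> (R ^^ k) x = y} * card (rot_orbit x) = L"
proof -
  \<comment> \<open>With z = R^j x, adding j modulo L to the exponent carries the exponents fixing x
    onto those sending x to z.\<close>
  have same: "card {k. k < L \<and> (R ^^ k) x = z} = card {k. k < L \<and> (R ^^ k) x = x}"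
    if "z \<in> rot_orbit x" for z
  proof -
    obtain j where j: "j < L" "z = (R ^^ j) x"
      using \<open>z \<in> rot_orbit x\<close> x by (auto simp: rot_orbit_bounded)
    have shift: "(R ^^ ((k + j) mod L)) x = (R ^^ j) ((R ^^ k) x)" for k
      using x by (simp add: Rpow_mod add.commute[of k] funpow_add)
    have unshift: "(R ^^ (L - j)) z = x"
      using j x R_period by (simp add: Rpow_Rpow)
    have shift': "(R ^^ ((k + (L - j)) mod L)) x = (R ^^ (L - j)) ((R ^^ k) x)" for k
      using x by (simp add: Rpow_mod add.commute[of k] funpow_add)
    have "bij_betw (\<lambda>k. (k + j) mod L) {k. k < L \<and> (R ^^ k) x = x} {k. k < L \<and> (R ^^ k) x = z}"
    proof (rule bij_betw_byWitness[where f' = "\<lambda>k. (k + (L - j)) mod L"])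
      show "(\<lambda>k. (k + j) mod L) ` {k. k < L \<and> (R ^^ k) x = x} \<subseteq> {k. k < L \<and> (R ^^ k) x = z}"
        using shift j L_pos by auto
      show "(\<lambda>k. (k + (L - j)) mod L) ` {k. k < L \<and> (R ^^ k) x = z} \<subseteq> {k. k < L \<and> (R ^^ k) x = x}"
        using shift' unshift L_pos by auto
      have "(k + j + (L - j)) mod L = k" "(k + (L - j) + j) mod L = k" if "k < L" for k
        using that j by (simp_all add: add.assoc)
      then show "\<forall>k\<in>{k. k < L \<and> (R ^^ k) x = x}. ((k + j) mod L + (L - j)) mod L = k"
        "\<forall>k\<in>{k. k < L \<and> (R ^^ k) x = z}. ((k + (L - j)) mod L + j) mod L = k"
        by (simp_all only: mod_add_left_eq) auto
    qed
    then show ?thesis by (simp add: bij_betw_same_card)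
  qed
  have "L = card {..<L}" by simp
  also have "\<dots> = (\<Sum>z\<in>(\<lambda>k. (R ^^ k) x) ` {..<L}. card {k. k \<in> {..<L} \<and> (R ^^ k) x = z})"
    using sum.image_gen[of "{..<L}" "\<lambda>_. 1 :: nat" "\<lambda>k. (R ^^ k) x"] by simp
  also have "\<dots> = (\<Sum>z\<in>rot_orbit x. card {k. k < L \<and> (R ^^ k) x = y})"
    unfolding rot_orbit_bounded[OF x, symmetric]
    by (rule sum.cong) (use same y in auto)
  finally show ?thesis by (simp add: mult.commute)
qed

text \<open>Pointwise, let s be the size of the rotation orbit of x. If T x lies in that orbit, both
  orbits agree, the weight is 2/s - 1/s = 1/s, and exactly L/s of the exponents give a reflection
  fixing x. Otherwise the full orbit has 2s elements, the weight is 0, and no reflection fixes x.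
  Summing over x and exchanging the sums gives the average.\<close>

lemma twice_full_minus_rot:
  "2 * real (card (full_orbit ` X)) - real (card (rot_orbit ` X)) =
     (\<Sum>k<L. real (card {x\<in>X. (R ^^ k) (T x) = x})) / real L"
proof -
  have weight: "2 / real (card (full_orbit x)) - 1 / real (card (rot_orbit x)) =
      (\<Sum>k<L. if (R ^^ k) (T x) = x then 1 else 0) / real L" if x: "x \<in> X" for x
  proof -
    have cnt: "(\<Sum>k<L. if (R ^^ k) (T x) = x then 1 else 0 :: real)
        = real (card {k. k < L \<and> (R ^^ k) (T x) = x})"
      by (simp add: sum.If_cases Int_def)
    have fin_orb: "finite (rot_orbit z)" if "z \<in> X" for z
      using that rot_orbit_sub fin finite_subset by blast
    have pos: "card (rot_orbit x) > 0"
      using fin_orb[OF x] rot_orbit_self[of x] by (auto simp: card_gt_0_iff)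
    show ?thesis
    proof (cases "x \<in> rot_orbit (T x)")
      case True
      then have eq: "rot_orbit (T x) = rot_orbit x"
        using x T_closed rot_orbit_eq by blast
      have "real (card {k. k < L \<and> (R ^^ k) (T x) = x}) * real (card (rot_orbit x)) = real L"
        using card_stabilizer[OF T_closed[OF x] True] eq by (metis of_nat_mult)
      then show ?thesis
        unfolding cnt using pos L_pos eq by (simp add: full_orbit_def field_simps)
    next
      case False
      then have "rot_orbit x \<inter> rot_orbit (T x) = {}"
        using x by (metis T_closed disjoint_iff rot_orbit_eq rot_orbit_self)
      moreover have "card (rot_orbit (T x)) = card (rot_orbit x)"
      proof (rule bij_betw_same_card[of T])
        show "bij_betw T (rot_orbit (T x)) (rot_orbit x)"
          using x T_rot_orbit[of x] T_rot_orbit[of "T x"] rot_orbit_sub[of x] rot_orbit_sub[of "T x"]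
          by (intro bij_betw_byWitness[where f' = T]) (auto simp: T_closed T_invol)
      qed
      ultimately have "card (full_orbit x) = 2 * card (rot_orbit x)"
        using fin_orb[OF x] fin_orb[OF T_closed[OF x]]
        by (simp add: full_orbit_def card_Un_disjoint)
      moreover have "{k. k < L \<and> (R ^^ k) (T x) = x} = {}"
        using False by (auto simp: rot_orbit_def) (metis rangeI)
      ultimately show ?thesis unfolding cnt by simp
    qed
  qed
  have "real (card (full_orbit ` X)) = (\<Sum>x\<in>X. 1 / real (card (full_orbit x)))"
  proof (rule card_classes[OF fin _ _ full_orbit_eq])
    show "full_orbit x \<subseteq> X" if "x \<in> X" for x
      using that rot_orbit_sub T_closed by (simp add: full_orbit_def)
  qed (simp_all add: full_orbit_def rot_orbit_self)
  moreover have "real (card (rot_orbit ` X)) = (\<Sum>x\<in>X. 1 / real (card (rot_orbit x)))"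
    by (rule card_classes[OF fin rot_orbit_sub rot_orbit_self rot_orbit_eq])
  ultimately have "2 * real (card (full_orbit ` X)) - real (card (rot_orbit ` X)) =
      (\<Sum>x\<in>X. 2 / real (card (full_orbit x)) - 1 / real (card (rot_orbit x)))"
    by (simp add: sum_distrib_left sum_subtractf)
  also have "\<dots> = (\<Sum>x\<in>X. (\<Sum>k<L. if (R ^^ k) (T x) = x then 1 else 0) / real L)"
    by (rule sum.cong) (auto simp: weight)
  also have "\<dots> = (\<Sum>k<L. \<Sum>x\<in>X. if (R ^^ k) (T x) = x then 1 else 0) / real L"
    by (subst sum.swap) (simp add: sum_divide_distrib)
  also have "\<dots> = (\<Sum>k<L. real (card {x\<in>X. (R ^^ k) (T x) = x})) / real L"
    using fin by (simp add: sum.If_cases Int_def)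
  finally show ?thesis .
qed

text \<open>Conjugating R^k T by R gives R^(k+2) T, so R carries the fixed points of the one
  bijectively onto those of the other. Only the parity of k matters.\<close>

lemma card_fixed_shift:
  "card {x\<in>X. (R ^^ (k + 2)) (T x) = x} = card {x\<in>X. (R ^^ k) (T x) = x}"
proof -
  have step: "(R ^^ (k + 2)) (T (R x)) = R ((R ^^ k) (T x))" if "x \<in> X" for x
  proof -
    have "(R ^^ (k + 2)) (T (R x)) = (R ^^ Suc k) (R (T (R x)))"
      by (simp add: funpow_swap1)
    then show ?thesis using RTR[OF that] by simp
  qed
  have surj: "x \<in> R ` X" if "x \<in> X" for x
    using that endo_inj_surj[OF fin _ R_inj] R_closed by blast
  have "{x\<in>X. (R ^^ (k + 2)) (T x) = x} = R ` {x\<in>X. (R ^^ k) (T x) = x}"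
  proof (intro equalityI subsetI)
    fix y assume y: "y \<in> {x\<in>X. (R ^^ (k + 2)) (T x) = x}"
    then obtain x where x: "x \<in> X" "y = R x" using surj by blast
    then have "(R ^^ k) (T x) = x"
      using y step[OF x(1)] inj_onD[OF R_inj] by (auto simp: Rpow_closed T_closed)
    then show "y \<in> R ` {x\<in>X. (R ^^ k) (T x) = x}" using x by auto
  qed (use step R_closed in auto)
  moreover have "inj_on R {x\<in>X. (R ^^ k) (T x) = x}"
    using R_inj by (rule inj_on_subset) auto
  ultimately show ?thesis by (simp add: card_image)
qed

lemma card_fixed_even: "card {x\<in>X. (R ^^ (2 * j)) (T x) = x} = card {x\<in>X. T x = x}"
  using card_fixed_shift by (induction j) (simp_all add: add.commute[of 2])

lemma card_fixed_odd: "card {x\<in>X. (R ^^ (2 * j + 1)) (T x) = x} = card {x\<in>X. R (T x) = x}"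
proof (induction j)
  case (Suc j)
  then show ?case using card_fixed_shift[of "2 * j + 1"] by (simp add: add.commute[of 2])
qed simp

end

section \<open>Non-crossing equivalence relations and their outer classes\<close>

text \<open>For an equivalence relation, a ~ b together with a ~ c and b ~ d puts all four points
  into one class, which is the absence of a crossing between distinct classes.\<close>

definition noncrossing_rel :: "(nat \<times> nat) set \<Rightarrow> bool" where
  "noncrossing_rel E \<longleftrightarrow>
     (\<forall>a b c d. a < b \<and> b < c \<and> c < d \<and> (a, c) \<in> E \<and> (b, d) \<in> E \<longrightarrow> (a, b) \<in> E)"

definition NCE :: "nat \<Rightarrow> (nat \<times> nat) set set" where
  "NCE n = {E. equiv {1..n} E \<and> noncrossing_rel E}"

text \<open>The cuts are the maxima of the outer classes, so their number is the number of outer classes.\<close>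

definition cuts :: "nat \<Rightarrow> (nat \<times> nat) set \<Rightarrow> nat set" where
  "cuts n E = {x\<in>{1..n}. \<forall>a c. a \<le> x \<and> x < c \<longrightarrow> (a, c) \<notin> E}"

lemma NCE_I:
  assumes "E \<subseteq> {1..n} \<times> {1..n}" "\<And>x. x \<in> {1..n} \<Longrightarrow> (x, x) \<in> E"
    "\<And>x y. (x, y) \<in> E \<Longrightarrow> (y, x) \<in> E"
    "\<And>x y z. (x, y) \<in> E \<Longrightarrow> (y, z) \<in> E \<Longrightarrow> (x, z) \<in> E"
    "\<And>a b c d. a < b \<Longrightarrow> b < c \<Longrightarrow> c < d \<Longrightarrow> (a, c) \<in> E \<Longrightarrow> (b, d) \<in> E \<Longrightarrow> (a, b) \<in> E"
  shows "E \<in> NCE n"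
  unfolding NCE_def mem_Collect_eq
proof
  show "equiv {1..n} E"
    using assms(1-4) by (intro equivI refl_onI symI transI)
  show "noncrossing_rel E"
    unfolding noncrossing_rel_def by (intro allI impI, elim conjE) (rule assms(5))
qed

lemma NCE_equiv: "E \<in> NCE n \<Longrightarrow> equiv {1..n} E"
  by (simp add: NCE_def)

lemma NCE_dom: "E \<in> NCE n \<Longrightarrow> (x, y) \<in> E \<Longrightarrow> x \<in> {1..n} \<and> y \<in> {1..n}"
  using equiv_type[OF NCE_equiv, of E n] by auto

lemma NCE_refl: "E \<in> NCE n \<Longrightarrow> x \<in> {1..n} \<Longrightarrow> (x, x) \<in> E"
  by (rule refl_onD[of "{1..n}"]) (simp_all add: NCE_def equiv_def)

lemma NCE_sym: "E \<in> NCE n \<Longrightarrow> (x, y) \<in> E \<Longrightarrow> (y, x) \<in> E"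
  by (rule symD) (simp_all add: NCE_def equiv_def)

lemma NCE_trans: "E \<in> NCE n \<Longrightarrow> (x, y) \<in> E \<Longrightarrow> (y, z) \<in> E \<Longrightarrow> (x, z) \<in> E"
  by (rule transD[of E x y z]) (simp_all add: NCE_def equiv_def)

lemma NCE_sym_iff: "E \<in> NCE n \<Longrightarrow> (x, y) \<in> E \<longleftrightarrow> (y, x) \<in> E"
  by (rule iffI) (simp_all add: NCE_sym)

lemma NCE_eq:
  assumes "E \<in> NCE n" "(x, y) \<in> E"
  shows "(x, z) \<in> E \<longleftrightarrow> (y, z) \<in> E" "(z, x) \<in> E \<longleftrightarrow> (z, y) \<in> E"
  using NCE_trans[OF assms(1), of x y z] NCE_trans[OF assms(1), of y x z]
    NCE_trans[OF assms(1), of z x y] NCE_trans[OF assms(1), of z y x] assms(2)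
    NCE_sym[OF assms] by iprover+

lemma NCE_cross:
  assumes "E \<in> NCE n" "(a, c) \<in> E" "(b, d) \<in> E" "a < b" "b < c" "c < d"
  shows "(a, b) \<in> E"
proof -
  have "noncrossing_rel E" using assms(1) by (simp add: NCE_def)
  from this[unfolded noncrossing_rel_def, rule_format, of a b c d] show ?thesis
    using assms(2-) by simp
qed

lemma finite_NCE: "finite (NCE n)"
proof (rule finite_subset)
  show "NCE n \<subseteq> Pow ({1..n} \<times> {1..n})"
    by (intro subsetI PowI) (auto dest!: NCE_equiv equiv_type)
qed simp

lemma finite_cuts: "finite (cuts n E)"
  by (simp add: cuts_def)

lemma cuts_sub: "cuts n E \<subseteq> {1..n}"
  by (auto simp: cuts_def)

lemma cutsD: "w \<in> cuts n E \<Longrightarrow> a \<le> w \<Longrightarrow> w < c \<Longrightarrow> (a, c) \<in> E \<Longrightarrow> False"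
  by (simp add: cuts_def)

text \<open>If two distinct cuts were related, the arc between them would pass over the smaller
  one.\<close>

lemma cuts_unique:
  assumes "E \<in> NCE n" "v \<in> cuts n E" "w \<in> cuts n E" "(v, w) \<in> E" shows "v = w"
proof (rule ccontr)
  assume "v \<noteq> w"
  then consider "v < w" | "w < v" by linarith
  then show False
    by cases (use cutsD[OF assms(2) order_refl _ assms(4)]
        cutsD[OF assms(3) order_refl _ NCE_sym[OF assms(1,4)]] in blast)+
qed

lemma cut_class_le:
  assumes "E \<in> NCE n" "w \<in> cuts n E" "(b, w) \<in> E" shows "b \<le> w"
  using cutsD[OF assms(2) order_refl _ NCE_sym[OF assms(1,3)]] by (metis leI)

text \<open>The class of a cut w is outer: an arc (a, c) of another class cannot pass over its
  member b. As no arc passes over w, c \<le> w. For c = w the claim is immediate, and otherwise a <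
  b < c < w is a crossing pattern.\<close>

lemma cut_class_exposed:
  assumes E: "E \<in> NCE n" and w: "w \<in> cuts n E" and bw: "(b, w) \<in> E"
    and ac: "(a, c) \<in> E" and lt: "a < b" "b < c"
  shows "(a, b) \<in> E"
proof -
  have "b \<le> w" using cut_class_le[OF E w bw] .
  then have "\<not> w < c" using cutsD[OF w, of a c] ac lt by auto
  show ?thesis
  proof (cases "c = w")
    case True
    then show ?thesis using ac NCE_eq(2)[OF E bw, of a] by simp
  next
    case False
    then show ?thesis
      using NCE_cross[OF E ac bw] lt \<open>\<not> w < c\<close> by simp
  qed
qed

lemma last_in_cuts: "E \<in> NCE n \<Longrightarrow> n \<ge> 1 \<Longrightarrow> n \<in> cuts n E"
  unfolding cuts_def
proof (intro CollectI conjI allI impI notI)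
  fix a c assume "E \<in> NCE n" "a \<le> n \<and> n < c" "(a, c) \<in> E"
  then show False using NCE_dom[of E n a c] by simp
qed simp

section \<open>Appending a last point\<close>

lemma sum_ranks:
  fixes h :: "nat \<Rightarrow> real" and A :: "nat set"
  assumes "finite A"
  shows "(\<Sum>w\<in>A. h (card {v\<in>A. v < w})) = (\<Sum>j<card A. h j)"
  using assms
proof (induction A rule: finite_linorder_max_induct)
  case (insert b A)
  have "{v \<in> insert b A. v < b} = A" using insert by auto
  moreover have "{v \<in> insert b A. v < w} = {v \<in> A. v < w}" if "w \<in> A" for w
    using insert that by auto
  ultimately have "(\<Sum>w\<in>insert b A. h (card {v \<in> insert b A. v < w})) =
      h (card A) + (\<Sum>w\<in>A. h (card {v\<in>A. v < w}))"
    using insert by (subst sum.insert) auto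
  then show ?case using insert by (subst card_insert_disjoint) auto
qed simp

text \<open>
  The new point \<open>Suc n\<close> joins the class of the cut \<open>w\<close>; it becomes a singleton for \<open>w = Suc n\<close>,
  where the image of \<open>{w}\<close> is empty.
\<close>

definition add_last :: "nat \<Rightarrow> (nat \<times> nat) set \<Rightarrow> nat \<Rightarrow> (nat \<times> nat) set" where
  "add_last n E w = E \<union> insert (Suc n) (E `` {w}) \<times> insert (Suc n) (E `` {w})"

lemma add_last_iff:
  assumes E: "E \<in> NCE n"
  shows "(x, y) \<in> add_last n E w \<longleftrightarrow> (x, y) \<in> E \<or> x = Suc n \<and> y = Suc n \<or>
     x = Suc n \<and> (w, y) \<in> E \<or> y = Suc n \<and> (w, x) \<in> E"
  using NCE_sym[OF E] NCE_trans[OF E] unfolding add_last_def by blast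

text \<open>Joining the new point to the class of a cut creates no crossing because no arc of
  another class passes over a point of that class.\<close>

lemma add_last_in_NCE:
  assumes E: "E \<in> NCE n" and w: "w \<in> insert (Suc n) (cuts n E)"
  shows "add_last n E w \<in> NCE (Suc n)"
proof (rule NCE_I)
  note iff = add_last_iff[OF E]
  have dom: "x \<le> n" "y \<le> n" if "(x, y) \<in> E" for x y
    using NCE_dom[OF E that] by auto
  show sub: "add_last n E w \<subseteq> {1..Suc n} \<times> {1..Suc n}"
    using equiv_type[OF NCE_equiv[OF E]] by (auto simp: add_last_def)
  show "(x, x) \<in> add_last n E w" if "x \<in> {1..Suc n}" for x
    using NCE_refl[OF E, of x] that by (cases "x = Suc n") (auto simp: iff)
  show "(y, x) \<in> add_last n E w" if "(x, y) \<in> add_last n E w" for x y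
    using that NCE_sym_iff[OF E, of x y] unfolding iff by (elim disjE) simp_all
  show "(x, z) \<in> add_last n E w" if "(x, y) \<in> add_last n E w" "(y, z) \<in> add_last n E w" for x y z
  proof -
    \<comment> \<open>The new relation is \<open>E\<close> together with all pairs from
      \<open>D\<close>. Since \<open>E\<close> never links a point of \<open>D\<close> to a point
      outside it, transitivity can be checked on membership in \<open>D\<close>.\<close>
    define D where "D = insert (Suc n) (E `` {w})"
    have D: "(p, q) \<in> add_last n E w \<longleftrightarrow> (p, q) \<in> E \<or> p \<in> D \<and> q \<in> D" for p q
      by (auto simp: add_last_def D_def)
    have "p \<in> D \<longleftrightarrow> q \<in> D" if "(p, q) \<in> E" for p q
      using dom[OF that] by (auto simp: D_def NCE_eq(2)[OF E that])
    note clos = this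
    show ?thesis
      using clos[of x y] clos[of y z] that NCE_trans[OF E, of x y z] unfolding D by (elim disjE) simp_all
  qed
  fix a b c d :: nat assume lt: "a < b" "b < c" "c < d"
    and ac: "(a, c) \<in> add_last n E w" and bd: "(b, d) \<in> add_last n E w"
  have "d \<le> Suc n" using bd sub by auto
  then have ac': "(a, c) \<in> E" using ac lt by (auto simp: iff)
  \<comment> \<open>Only pairs involving \<open>Suc n\<close> are new. If d = \<open>Suc n\<close>,
    then b belongs to the class of the cut w, which is exposed.\<close>
  show "(a, b) \<in> add_last n E w"
  proof (cases "d = Suc n")
    case True
    then have wb: "(w, b) \<in> E" using bd lt \<open>d \<le> Suc n\<close> dom[of b d] by (auto simp: iff)
    then have w': "w \<in> cuts n E" using w dom[of w b] by auto
    have "(a, b) \<in> E"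
      by (rule cut_class_exposed[OF E w' NCE_sym[OF E wb] ac']) (use lt in simp_all)
    then show ?thesis by (simp add: iff)
  next
    case False
    then have "(b, d) \<in> E" using bd lt \<open>d \<le> Suc n\<close> by (auto simp: iff)
    then show ?thesis using NCE_cross[OF E ac'] lt by (simp add: iff)
  qed
qed

text \<open>A cut v < w survives because no arc passes over v, so the whole class of w lies above v
  and so do the new arcs. A cut v \<ge> w is covered by the new arc from w to \<open>Suc n\<close>.
  For w = \<open>Suc n\<close> no arc over an old point is added.\<close>

lemma cuts_add_last:
  assumes E: "E \<in> NCE n" and w: "w \<in> insert (Suc n) (cuts n E)"
  shows "cuts (Suc n) (add_last n E w) = insert (Suc n) {v\<in>cuts n E. v < w}"
proof (rule Set.set_eqI)
  fix v
  note iff = add_last_iff[OF E]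
  have dom: "x \<le> n" "y \<le> n" if "(x, y) \<in> E" for x y
    using NCE_dom[OF E that] by auto
  consider "v = Suc n" | "v \<le> n" | "v > Suc n" by linarith
  then show "v \<in> cuts (Suc n) (add_last n E w) \<longleftrightarrow> v \<in> insert (Suc n) {v\<in>cuts n E. v < w}"
  proof cases
    case 1
    then show ?thesis
      using last_in_cuts[OF add_last_in_NCE[OF E w]] by simp
  next
    case 2
    have "v \<in> cuts (Suc n) (add_last n E w) \<longleftrightarrow> v \<in> cuts n E \<and> (\<forall>a\<le>v. (w, a) \<notin> E)"
    proof -
      have "(a, c) \<in> add_last n E w \<longleftrightarrow> (a, c) \<in> E \<or> c = Suc n \<and> (w, a) \<in> E" if "a \<le> v" for a c
        using that 2 dom(1)[of "Suc n" c] by (auto simp: iff)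
      moreover have "v < Suc n" "v \<in> {1..Suc n} \<longleftrightarrow> v \<in> {1..n}" using 2 by auto
      ultimately show ?thesis by (auto simp: cuts_def)
    qed
    also have "\<dots> \<longleftrightarrow> v \<in> cuts n E \<and> v < w"
    proof (rule conj_cong[OF refl])
      assume v: "v \<in> cuts n E"
      show "(\<forall>a\<le>v. (w, a) \<notin> E) \<longleftrightarrow> v < w"
      proof
        assume a: "\<forall>a\<le>v. (w, a) \<notin> E"
        show "v < w"
        proof (rule ccontr)
          assume "\<not> v < w"
          then have "w \<in> {1..n}" using w 2 cuts_sub[of n E] by auto
          then have "(w, w) \<in> E" by (rule NCE_refl[OF E])
          with a \<open>\<not> v < w\<close> show False by auto
        qed
      next
        assume "v < w"
        then show "\<forall>a\<le>v. (w, a) \<notin> E"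
          using cutsD[OF v, of _ w] NCE_sym_iff[OF E, of w] by auto
      qed
    qed
    finally show ?thesis using 2 by auto
  next
    case 3
    then show ?thesis
      using cuts_sub[of n E] cuts_sub[of "Suc n" "add_last n E w"] by auto
  qed
qed

lemma restrict_NCE:
  assumes E: "E \<in> NCE n" and "m \<le> n"
  shows "E \<inter> {1..m} \<times> {1..m} \<in> NCE m"
proof (rule NCE_I)
  fix x assume "x \<in> {1..m}"
  then show "(x, x) \<in> E \<inter> {1..m} \<times> {1..m}" using NCE_refl[OF E] assms(2) by auto
next
  fix a b c d assume "a < b" "b < c" "c < d"
    "(a, c) \<in> E \<inter> {1..m} \<times> {1..m}" "(b, d) \<in> E \<inter> {1..m} \<times> {1..m}"
  then show "(a, b) \<in> E \<inter> {1..m} \<times> {1..m}" using NCE_cross[OF E] by blast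
qed (auto intro: NCE_sym[OF E] NCE_trans[OF E])

text \<open>Converse of \<open>cut_class_exposed\<close>: the maximum w of an outer class is a cut.
  If (a, c) passed over w, then a ~ x, by the hypothesis when a < x and by non-crossing of (x, w)
  and (a, c) when x < a < w. Then c would belong to the class and exceed its maximum.\<close>

lemma class_max_cut:
  assumes E: "E \<in> NCE n" and x: "x \<in> {1..n}"
    and outer: "\<And>a c. a < x \<Longrightarrow> x < c \<Longrightarrow> (a, c) \<in> E \<Longrightarrow> (a, x) \<in> E"
  obtains w where "w \<in> cuts n E" "(x, w) \<in> E"
proof -
  define w where "w = Max (E `` {x})"
  have fin: "finite (E `` {x})"
    by (rule finite_subset[of _ "{1..n}"]) (use NCE_dom[OF E] in auto)
  have "E `` {x} \<noteq> {}" using NCE_refl[OF E x] by auto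
  then have xw: "(x, w) \<in> E" using Max_in[OF fin] by (auto simp: w_def)
  have max: "y \<le> w" if "(x, y) \<in> E" for y
    using Max_ge[OF fin] that by (auto simp: w_def)
  have "w \<in> cuts n E"
    unfolding cuts_def
  proof (intro CollectI conjI allI impI notI)
    show "w \<in> {1..n}" using NCE_dom[OF E xw] by simp
    fix a c assume ac: "a \<le> w \<and> w < c" "(a, c) \<in> E"
    have "x \<le> w" using max[OF NCE_refl[OF E x]] .
    have "(a, x) \<in> E"
    proof (cases "a < x")
      case True then show ?thesis using outer[of a c] ac \<open>x \<le> w\<close> by simp
    next
      case False
      show ?thesis
      proof (cases "x = a \<or> a = w")
        case True then show ?thesis
          using NCE_refl[OF E x] NCE_sym[OF E xw] by (elim disjE) simp_all
      next
        case False
        then have "(x, a) \<in> E"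
          using NCE_cross[OF E xw ac(2)] ac(1) \<open>\<not> a < x\<close> by simp
        then show ?thesis by (rule NCE_sym[OF E])
      qed
    qed
    then have "(x, c) \<in> E" using NCE_trans[OF E NCE_sym[OF E] ac(2)] by simp
    then show False using max[of c] ac(1) by simp
  qed
  then show ?thesis using xw that by blast
qed

text \<open>Delete \<open>Suc n\<close>. If it was a singleton, take w = \<open>Suc n\<close>.
  Otherwise let x be related to it: an arc over x from a different class would cross (x,
  \<open>Suc n\<close>), so the class of x is outer and w is its cut.\<close>

lemma add_last_surj:
  assumes E: "E \<in> NCE (Suc n)"
  obtains E' w where "E' \<in> NCE n" "w \<in> insert (Suc n) (cuts n E')" "E = add_last n E' w"
proof -
  define E' where "E' = E \<inter> {1..n} \<times> {1..n}"
  have E': "E' \<in> NCE n" unfolding E'_def by (rule restrict_NCE[OF E]) simp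
  note iff = add_last_iff[OF E']
  have in_E': "(p, q) \<in> E' \<longleftrightarrow> p \<in> {1..n} \<and> q \<in> {1..n} \<and> (p, q) \<in> E" for p q
    by (auto simp: E'_def)
  have dom: "x = Suc n \<or> x \<in> {1..n}" "y = Suc n \<or> y \<in> {1..n}" if "(x, y) \<in> E" for x y
    using NCE_dom[OF E that] by auto
  have refl: "(Suc n, Suc n) \<in> E" using NCE_refl[OF E] by auto
  show thesis
  proof (cases "\<exists>x\<in>{1..n}. (x, Suc n) \<in> E")
    case False
    have "E = add_last n E' (Suc n)"
    proof (rule Set.set_eqI, clarify)
      fix x y
      have F: "(z, Suc n) \<in> E \<longleftrightarrow> z = Suc n" "(Suc n, z) \<in> E \<longleftrightarrow> z = Suc n" for z
        using False dom(1)[of z "Suc n"] refl NCE_sym_iff[OF E, of z "Suc n"] by auto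
      show "(x, y) \<in> E \<longleftrightarrow> (x, y) \<in> add_last n E' (Suc n)"
        using dom[of x y] by (cases "x = Suc n"; cases "y = Suc n") (auto simp: iff F in_E')
    qed
    then show thesis using that E' by blast
  next
    case True
    then obtain x where x: "x \<in> {1..n}" "(x, Suc n) \<in> E" ..
    have "(a, x) \<in> E'" if "a < x" "x < c" "(a, c) \<in> E'" for a c
      using NCE_cross[OF E, of a c x "Suc n"] that x by (auto simp: E'_def)
    then obtain w where w: "w \<in> cuts n E'" "(x, w) \<in> E'"
      using class_max_cut[OF E' x(1)] by blast
    have wE: "(w, y) \<in> E \<longleftrightarrow> (y, Suc n) \<in> E" for y
    proof -
      have "(x, w) \<in> E" using w(2) by (simp add: E'_def)
      then have "(w, Suc n) \<in> E" using x(2) NCE_eq(1)[OF E, of x w] by simp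
      then show ?thesis using NCE_eq(1)[OF E, of w "Suc n" y] NCE_sym_iff[OF E, of y "Suc n"] by simp
    qed
    have "E = add_last n E' w"
    proof (rule Set.set_eqI, clarify)
      fix a b
      have w': "w \<in> {1..n}" using w(1) cuts_sub[of n E'] by auto
      show "(a, b) \<in> E \<longleftrightarrow> (a, b) \<in> add_last n E' w"
        using dom[of a b] refl w' NCE_sym_iff[OF E, of "Suc n" b]
        by (cases "a = Suc n"; cases "b = Suc n") (auto simp: iff in_E' wE)
    qed
    then show thesis using that E' w by blast
  qed
qed

text \<open>Restriction to {1..n} recovers \<open>E\<close>. The old members of the class of
  \<open>Suc n\<close> then recover w: they contain exactly one cut, or there are none and w =
  \<open>Suc n\<close>.\<close>

lemma add_last_inj:
  assumes E: "E \<in> NCE n" "w \<in> insert (Suc n) (cuts n E)"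
    and E': "E' \<in> NCE n" "w' \<in> insert (Suc n) (cuts n E')"
    and eq: "add_last n E w = add_last n E' w'"
  shows "E = E' \<and> w = w'"
proof -
  have restrict: "add_last n F v \<inter> {1..n} \<times> {1..n} = F" if "F \<in> NCE n" for F v
    using NCE_dom[OF that] by (auto simp: add_last_iff[OF that])
  have "E = E'" using restrict E(1) E'(1) eq by metis
  moreover have "w = w'"
  proof -
    have cls: "(v, x) \<in> E \<longleftrightarrow> x \<in> {1..n} \<and> (Suc n, x) \<in> add_last n E v" for v x
      using NCE_dom[OF E(1), of v x] NCE_dom[OF E(1), of "Suc n" x] by (auto simp: add_last_iff[OF E(1)])
    have same: "(w, x) \<in> E \<longleftrightarrow> (w', x) \<in> E" for x
      unfolding cls eq using \<open>E = E'\<close> cls[of w'] by simp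
    show ?thesis
    proof (cases "w \<in> {1..n}")
      case True
      then have "(w', w) \<in> E" using same[of w] NCE_refl[OF E(1)] by simp
      then have "w' \<in> {1..n}" using NCE_dom[OF E(1), of w' w] by simp
      then have "w' \<in> cuts n E" "w \<in> cuts n E" using True E(2) E'(2) \<open>E = E'\<close> by auto
      then show ?thesis using cuts_unique[OF E(1)] \<open>(w', w) \<in> E\<close> by blast
    next
      case False
      then have "w = Suc n" using E(2) cuts_sub[of n E] by auto
      have "w' \<notin> {1..n}"
        using same[of w'] NCE_refl[OF E(1), of w'] NCE_dom[OF E(1), of w w'] False by blast
      then show ?thesis using \<open>w = Suc n\<close> E'(2) cuts_sub[of n E'] by auto
    qed
  qed
  ultimately show ?thesis by simp
qed

section \<open>Sums weighted by the number of outer classes\<close>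

definition cut_sum :: "nat \<Rightarrow> (nat \<Rightarrow> real) \<Rightarrow> real" where
  "cut_sum n h = (\<Sum>E\<in>NCE n. h (card (cuts n E)))"

lemma NCE_0: "NCE 0 = {{}}"
proof -
  have "{} \<in> NCE 0" by (rule NCE_I) auto
  moreover have "E = {}" if "E \<in> NCE 0" for E using NCE_dom[OF that] by auto
  ultimately show ?thesis by auto
qed

lemma cut_sum_0: "cut_sum 0 h = h 0"
  by (simp add: cut_sum_def NCE_0 cuts_def)

text \<open>Appending a point is a bijection from pairs (E, w). If \<open>E\<close> has k cuts, the
  k + 1 choices of w in increasing order produce 1, ..., k + 1 cuts. Deleting a point thus becomes a
  linear operator on the weight.\<close>

lemma cut_sum_Suc: "cut_sum (Suc n) h = cut_sum n (\<lambda>k. \<Sum>j=1..Suc k. h j)"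
proof -
  let ?S = "SIGMA E:NCE n. insert (Suc n) (cuts n E)"
  have bij: "bij_betw (\<lambda>(E, w). add_last n E w) ?S (NCE (Suc n))"
    unfolding bij_betw_def
  proof
    show "inj_on (\<lambda>(E, w). add_last n E w) ?S"
    proof (rule inj_onI, clarify)
      fix E w E' w'
      assume "E \<in> NCE n" "w \<in> insert (Suc n) (cuts n E)"
        "E' \<in> NCE n" "w' \<in> insert (Suc n) (cuts n E')" "add_last n E w = add_last n E' w'"
      then show "E = E' \<and> w = w'" by (rule add_last_inj)
    qed
    show "(\<lambda>(E, w). add_last n E w) ` ?S = NCE (Suc n)"
    proof (intro equalityI subsetI)
      fix E assume "E \<in> NCE (Suc n)"
      then obtain E' w where "E' \<in> NCE n" "w \<in> insert (Suc n) (cuts n E')" "E = add_last n E' w"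
        by (rule add_last_surj)
      then show "E \<in> (\<lambda>(E, w). add_last n E w) ` ?S"
        by (intro image_eqI[of _ _ "(E', w)"]) simp_all
    qed (clarify, rule add_last_in_NCE)
  qed
  have inner: "(\<Sum>w\<in>insert (Suc n) (cuts n E). h (card (cuts (Suc n) (add_last n E w)))) =
      (\<Sum>j=1..Suc (card (cuts n E)). h j)" if E: "E \<in> NCE n" for E
  proof -
    let ?A = "insert (Suc n) (cuts n E)"
    have fin: "finite ?A" by (simp add: finite_cuts)
    have new: "Suc n \<notin> cuts n E" using cuts_sub[of n E] by auto
    \<comment> \<open>The new number of cuts is one more than the rank of w among all choices, since
      \<open>Suc n\<close> is the largest of them and lies below none.\<close>
    have "(\<Sum>w\<in>?A. h (card (cuts (Suc n) (add_last n E w)))) =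
        (\<Sum>w\<in>?A. h (Suc (card {v\<in>?A. v < w})))"
    proof (rule sum.cong[OF refl])
      fix w assume w: "w \<in> ?A"
      have "{v\<in>?A. v < w} = {v\<in>cuts n E. v < w}" using w cuts_sub[of n E] by auto
      then show "h (card (cuts (Suc n) (add_last n E w))) = h (Suc (card {v\<in>?A. v < w}))"
        using new finite_cuts by (simp add: cuts_add_last[OF E w])
    qed
    also have "\<dots> = (\<Sum>j<card ?A. h (Suc j))"
      by (rule sum_ranks[OF fin])
    also have "\<dots> = (\<Sum>j=1..card ?A. h j)"
      by (simp add: sum.atLeast1_atMost_eq)
    finally show ?thesis using new finite_cuts by simp
  qed
  have "cut_sum (Suc n) h = (\<Sum>(E, w)\<in>?S. h (card (cuts (Suc n) (add_last n E w))))"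
    unfolding cut_sum_def
    by (subst sum.reindex_bij_betw[OF bij, symmetric]) (simp add: case_prod_unfold)
  also have "\<dots> = (\<Sum>E\<in>NCE n. \<Sum>w\<in>insert (Suc n) (cuts n E). h (card (cuts (Suc n) (add_last n E w))))"
    by (subst sum.Sigma) (auto simp: finite_NCE finite_cuts)
  also have "\<dots> = cut_sum n (\<lambda>k. \<Sum>j=1..Suc k. h j)"
    unfolding cut_sum_def by (rule sum.cong[OF refl]) (rule inner)
  finally show ?thesis .
qed

text \<open>For n \<ge> 1 the point n is always a cut, so the count is positive. This lets 2^(k -
  1), where the subtraction truncates at k = 0, be exchanged for 2^k / 2.\<close>

lemma cut_sum_cong:
  assumes "\<And>k. k \<ge> 1 \<Longrightarrow> h k = h' k" "n \<ge> 1"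
  shows "cut_sum n h = cut_sum n h'"
  unfolding cut_sum_def
proof (rule sum.cong[OF refl])
  fix E assume "E \<in> NCE n"
  then have "cuts n E \<noteq> {}" using last_in_cuts assms(2) by blast
  then show "h (card (cuts n E)) = h' (card (cuts n E))"
    using finite_cuts by (intro assms(1)) (simp add: Suc_le_eq card_gt_0_iff)
qed

text \<open>The weight obtained from \<open>2^k\<close> after \<open>m\<close> applications of the rule in \<open>cut_sum_Suc\<close>.\<close>

definition mid_binomials :: "nat \<Rightarrow> nat \<Rightarrow> real" where
  "mid_binomials m k = (\<Sum>j=m..m+k. real ((2 * m + k) choose j))"

text \<open>Pascal's rule splits the left side into two windows of the row 2m + k + 2. Moving the
  top term, at index m + k + 2, from the first window to the second yields the two sums on the
  right.\<close>

lemma mid_binomials_diff: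
  "mid_binomials (Suc m) (Suc k) = mid_binomials (Suc m) k + mid_binomials m (k + 2)"
proof -
  have "mid_binomials (Suc m) (Suc k) =
      (\<Sum>j=Suc m..Suc (Suc (m + k)). real ((2 * m + k + 2) choose j) + real ((2 * m + k + 2) choose (j - 1)))"
    unfolding mid_binomials_def
  proof (rule sum.cong)
    fix j assume "j \<in> {Suc m..Suc (Suc (m + k))}"
    then obtain i where "j = Suc i" by (cases j) auto
    moreover have "2 * Suc m + Suc k = Suc (2 * m + k + 2)" by simp
    ultimately show "real ((2 * Suc m + Suc k) choose j) =
      real ((2 * m + k + 2) choose j) + real ((2 * m + k + 2) choose (j - 1))"
      by (simp only: binomial_Suc_Suc of_nat_add diff_Suc_1 add.commute)
  qed simp
  also have "\<dots> = (\<Sum>j=Suc m..Suc (Suc (m + k)). real ((2 * m + k + 2) choose j)) +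
      (\<Sum>j=m..Suc (m + k). real ((2 * m + k + 2) choose j))"
    by (simp only: sum.distrib sum.shift_bounds_cl_Suc_ivl diff_Suc_1)
  also have "\<dots> = (\<Sum>j=Suc m..Suc (m + k). real ((2 * m + k + 2) choose j)) +
      (\<Sum>j=m..Suc (Suc (m + k)). real ((2 * m + k + 2) choose j))"
    by simp
  finally show ?thesis by (simp add: mid_binomials_def)
qed

text \<open>Raising m by one is exactly the weight operator of \<open>cut_sum_Suc\<close>. The
  induction on k adds the term with index k + 2 supplied by
  \<open>mid_binomials_diff\<close>.\<close>

lemma mid_binomials_Suc: "mid_binomials (Suc m) k = (\<Sum>j=1..Suc k. mid_binomials m j)"
proof (induction k)
  case 0
  have "mid_binomials (Suc m) 0 = real ((2 * m + 1) choose m) + real ((2 * m + 1) choose (m + 1))"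
    by (simp add: mid_binomials_def)
  then show ?case by (simp add: mid_binomials_def)
next
  case (Suc k)
  then show ?case by (simp add: mid_binomials_diff)
qed

text \<open>Each deleted point raises m by one, so m + n is invariant. With no points left, the
  window at k = 0 is the single central coefficient.\<close>

lemma cut_sum_mid_binomials: "cut_sum n (mid_binomials m) = real ((2 * (m + n)) choose (m + n))"
proof (induction n arbitrary: m)
  case 0
  then show ?case by (simp add: cut_sum_0 mid_binomials_def)
next
  case (Suc n)
  have "cut_sum (Suc n) (mid_binomials m) = cut_sum n (mid_binomials (Suc m))"
    by (simp add: cut_sum_Suc mid_binomials_Suc[abs_def])
  then show ?case using Suc[of "Suc m"] by simp
qed

lemma cut_sum_pow: "cut_sum n (\<lambda>k. 2 ^ k) = real ((2 * n) choose n)"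
proof -
  have "mid_binomials 0 k = 2 ^ k" for k
  proof -
    have "real (\<Sum>j\<le>k. k choose j) = 2 ^ k" by (simp only: choose_row_sum of_nat_power of_nat_numeral)
    then show ?thesis by (simp add: mid_binomials_def atMost_atLeast0)
  qed
  then show ?thesis using cut_sum_mid_binomials[of n 0] by (simp add: mid_binomials_def[abs_def])
qed

lemma cut_sum_pow_minus_1:
  assumes "n \<ge> 1"
  shows "cut_sum n (\<lambda>k. 2 ^ (k - 1)) = real ((2 * n) choose n) / 2"
proof -
  have "cut_sum n (\<lambda>k. 2 ^ (k - 1)) = cut_sum n (\<lambda>k. 2 ^ k / 2)"
    by (rule cut_sum_cong[OF _ assms]) (simp add: power_diff)
  also have "\<dots> = cut_sum n (\<lambda>k. 2 ^ k) / 2"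
    by (simp add: cut_sum_def sum_divide_distrib)
  finally show ?thesis by (simp add: cut_sum_pow)
qed

text \<open>One step of \<open>cut_sum_Suc\<close> turns this weight into 1 + (1 + 2 + ... +
  2^(k-1)) = 2^k, which reduces the sum to \<open>cut_sum_pow\<close> on one point fewer.\<close>

lemma cut_sum_pow_minus_2:
  "cut_sum (Suc n) (\<lambda>k. 2 ^ (k - (if k = 1 then 1 else 2))) = real ((2 * n) choose n)"
proof -
  have "(\<Sum>j=1..Suc k. 2 ^ (j - (if j = 1 then 1 else 2)) :: real) = 2 ^ k" for k
    by (induction k) auto
  then show ?thesis by (simp only: cut_sum_Suc cut_sum_pow)
qed

section \<open>Relations invariant under a reflection\<close>

text \<open>For a map injective on the points of a finite relation, this inclusion of the image
  already amounts to equality.\<close>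

definition rel_invariant :: "(nat \<Rightarrow> nat) \<Rightarrow> (nat \<times> nat) set \<Rightarrow> bool" where
  "rel_invariant g E \<longleftrightarrow> (\<forall>x y. (x, y) \<in> E \<longrightarrow> (g x, g y) \<in> E)"

text \<open>
  The axis leaves \<open>{1..m}\<close> on one side, axis points included; only \<open>1\<close> and \<open>m\<close> can lie on the axis.
\<close>

locale line_reflection =
  fixes L m :: nat and r :: "nat \<Rightarrow> nat"
  assumes m_le: "m \<le> L"
    and r_closed: "x \<in> {1..L} \<Longrightarrow> r x \<in> {1..L}"
    and r_invol: "x \<in> {1..L} \<Longrightarrow> r (r x) = x"
    and r_upper: "x \<in> {1..L} \<Longrightarrow> m < x \<Longrightarrow> r x \<le> m"
    and r_lower: "x \<in> {1..L} \<Longrightarrow> x \<le> m \<Longrightarrow> r x = x \<and> (x = 1 \<or> x = m) \<or> m < r x"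
    and r_anti: "x \<in> {1..L} \<Longrightarrow> y \<in> {1..L} \<Longrightarrow> m < x \<Longrightarrow> x < y \<Longrightarrow> r y < r x"
begin

definition fold_line :: "nat \<Rightarrow> nat" where
  "fold_line x = (if x \<le> m then x else r x)"

text \<open>
  A set \<open>W\<close> of cuts marks the outer classes of the half that are joined to their mirror images;
  the classes of axis points must be among them.
\<close>

definition marked :: "(nat \<times> nat) set \<Rightarrow> nat set \<Rightarrow> nat \<Rightarrow> bool" where
  "marked E W x \<longleftrightarrow> (\<exists>w\<in>W. (x, w) \<in> E)"

definition forced :: "(nat \<times> nat) set \<Rightarrow> nat set" where
  "forced E = {v\<in>cuts m E. \<exists>p\<in>{1..m}. r p = p \<and> (p, v) \<in> E}"

definition markings :: "(nat \<times> nat) set \<Rightarrow> nat set set" where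
  "markings E = {W. forced E \<subseteq> W \<and> W \<subseteq> cuts m E}"

text \<open>An unmarked class yields two separate mirror copies, a marked one is glued to its mirror
  image. The mark is tested at one end only, as related points are marked alike.\<close>

definition unfold_line :: "(nat \<times> nat) set \<Rightarrow> nat set \<Rightarrow> (nat \<times> nat) set" where
  "unfold_line E W = {(x, y). x \<in> {1..L} \<and> y \<in> {1..L} \<and> (fold_line x, fold_line y) \<in> E \<and>
     (marked E W (fold_line x) \<or> (x \<le> m \<longleftrightarrow> y \<le> m))}"

lemma unfold_line_iff: "(x, y) \<in> unfold_line E W \<longleftrightarrow> x \<in> {1..L} \<and> y \<in> {1..L} \<and>
    (fold_line x, fold_line y) \<in> E \<and> (marked E W (fold_line x) \<or> (x \<le> m \<longleftrightarrow> y \<le> m))"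
  by (simp add: unfold_line_def)

lemma fold_line_range: "x \<in> {1..L} \<Longrightarrow> fold_line x \<in> {1..m}"
  using r_closed[of x] r_upper[of x] by (auto simp: fold_line_def)

lemma fold_line_r: "x \<in> {1..L} \<Longrightarrow> fold_line (r x) = fold_line x"
  using r_upper[of x] r_lower[of x] r_invol[of x] by (auto simp: fold_line_def)

lemma r_inj: "x \<in> {1..L} \<Longrightarrow> y \<in> {1..L} \<Longrightarrow> r x = r y \<Longrightarrow> x = y"
  using r_invol by metis

lemma r_anti_lower:
  assumes "x \<in> {1..L}" "y \<in> {1..L}" "x < y" "m < r x" "m < r y"
  shows "r y < r x"
proof (rule ccontr)
  assume "\<not> r y < r x"
  moreover have "r x \<noteq> r y" using r_inj[of x y] assms by auto
  ultimately have "r (r y) < r (r x)" using r_anti[of "r x" "r y"] r_closed assms by auto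
  then show False using assms by (simp add: r_invol)
qed

text \<open>An axis point is an end of the half, so no arc of the half passes over it and its class
  has a cut.\<close>

lemma fixed_outer:
  assumes E: "E \<in> NCE m" and p: "p \<in> {1..m}" "r p = p"
  obtains v where "v \<in> forced E" "(p, v) \<in> E"
proof -
  have "p = 1 \<or> p = m" using r_lower[of p] p m_le by auto
  have "(a, p) \<in> E" if "a < p" "p < c" "(a, c) \<in> E" for a c
    using NCE_dom[OF E that(3)] that(1,2) \<open>p = 1 \<or> p = m\<close> by auto
  then obtain v where "v \<in> cuts m E" "(p, v) \<in> E"
    using class_max_cut[OF E p(1)] by blast
  then show ?thesis using that[of v] p unfolding forced_def by blast
qed

lemma marked_fixed:
  assumes "E \<in> NCE m" "W \<in> markings E" "p \<in> {1..m}" "r p = p"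
  shows "marked E W p"
  using fixed_outer[OF assms(1,3,4)] assms(2) unfolding markings_def marked_def by blast

lemma marked_eq: "E \<in> NCE m \<Longrightarrow> (x, y) \<in> E \<Longrightarrow> marked E W x \<longleftrightarrow> marked E W y"
  by (simp add: marked_def NCE_eq(1)[of E m x y])

lemma marked_exposed:
  assumes E: "E \<in> NCE m" and W: "W \<in> markings E"
    and b: "marked E W b" and ac: "(a, c) \<in> E" and lt: "a < b" "b < c"
  shows "(a, b) \<in> E"
proof -
  obtain w where "w \<in> cuts m E" "(b, w) \<in> E"
    using b W by (auto simp: marked_def markings_def)
  then show ?thesis using cut_class_exposed[OF E _ _ ac lt] by simp
qed

text \<open>Two nested distinct marked classes would have to cross one of the two cuts at their maxima.\<close>

lemma marked_nested:
  assumes E: "E \<in> NCE m" and W: "W \<in> markings E" and a: "marked E W a" and b: "marked E W b"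
    and as: "(a, s) \<in> E" and bt: "(b, t) \<in> E" and lt: "a < b" "t < s"
  shows "(a, b) \<in> E"
proof -
  obtain v where v: "v \<in> cuts m E" "(a, v) \<in> E"
    using a W by (auto simp: marked_def markings_def)
  obtain w where w: "w \<in> cuts m E" "(b, w) \<in> E"
    using b W by (auto simp: marked_def markings_def)
  have "s \<le> v" using cut_class_le[OF E v(1), of s] v(2) as NCE_eq(1)[OF E as] by simp
  have "b \<le> w" using cut_class_le[OF E w] .
  have tw: "(t, w) \<in> E" using w(2) NCE_eq(1)[OF E bt] by simp
  have "\<not> v < w" using cutsD[OF v(1) _ _ tw] lt \<open>s \<le> v\<close> by auto
  moreover have "\<not> w < v" using cutsD[OF w(1) _ _ v(2)] lt \<open>b \<le> w\<close> by auto
  ultimately have "v = w" by simp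
  then show ?thesis using v(2) w(2) NCE_eq(2)[OF E w(2)] by simp
qed

text \<open>Folding reverses the order beyond the axis, so a crossing pattern in the circle becomes
  a crossing, covering or nesting pattern in the half, according to how many of the four points lie
  beyond it.\<close>

lemma unfold_in_NCE:
  assumes E: "E \<in> NCE m" and W: "W \<in> markings E"
  shows "unfold_line E W \<in> NCE L"
proof (rule NCE_I)
  note iff = unfold_line_iff and meq = marked_eq[OF E]
  show "unfold_line E W \<subseteq> {1..L} \<times> {1..L}" by (auto simp: iff)
  show "(x, x) \<in> unfold_line E W" if "x \<in> {1..L}" for x
    using that fold_line_range NCE_refl[OF E] by (simp add: iff)
  show "(y, x) \<in> unfold_line E W" if "(x, y) \<in> unfold_line E W" for x y
  proof -
    have e: "(fold_line x, fold_line y) \<in> E" using that by (simp add: iff)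
    then show ?thesis using that meq[OF e] NCE_sym[OF E e] by (auto simp: iff)
  qed
  show "(x, z) \<in> unfold_line E W" if "(x, y) \<in> unfold_line E W" "(y, z) \<in> unfold_line E W" for x y z
  proof -
    have e: "(fold_line x, fold_line y) \<in> E" "(fold_line y, fold_line z) \<in> E"
      using that by (simp_all add: iff)
    then show ?thesis using that meq[OF e(1)] NCE_trans[OF E e] by (auto simp: iff)
  qed
  fix a b c d :: nat
  assume lt: "a < b" "b < c" "c < d"
    and ac: "(a, c) \<in> unfold_line E W" and bd: "(b, d) \<in> unfold_line E W"
  have dom: "a \<in> {1..L}" "b \<in> {1..L}" "c \<in> {1..L}" "d \<in> {1..L}"
    using ac bd by (simp_all add: iff)
  have ac': "(fold_line a, fold_line c) \<in> E" and bd': "(fold_line b, fold_line d) \<in> E"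
    using ac bd by (simp_all add: iff)
  \<comment> \<open>With none or all four points beyond the axis, the folded arcs cross. With one,
    an arc covers the marked point b. With two, both classes are marked and their arcs are nested.
    With three, the folded arc of b and d covers the marked point \<open>r c\<close>.\<close>
  consider "d \<le> m" | "c \<le> m" "m < d" | "b \<le> m" "m < c" | "a \<le> m" "m < b" | "m < a"
    by linarith
  then show "(a, b) \<in> unfold_line E W"
  proof cases
    case 1
    then have "(a, b) \<in> E" using NCE_cross[OF E, of a c b d] ac' bd' lt by (simp add: fold_line_def)
    then show ?thesis using 1 lt dom by (simp add: iff fold_line_def)
  next
    case 2
    then have "marked E W b" using bd lt by (auto simp: iff fold_line_def)
    then have "(a, b) \<in> E"
      using marked_exposed[OF E W, of b a c] ac' lt 2 by (simp add: fold_line_def)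
    then show ?thesis using 2 lt dom by (simp add: iff fold_line_def)
  next
    case 3
    then have "marked E W a" "marked E W b" "(a, r c) \<in> E" "(b, r d) \<in> E"
      using ac bd lt by (auto simp: iff fold_line_def)
    moreover have "r d < r c" using r_anti[of c d] dom 3 lt by simp
    ultimately have "(a, b) \<in> E" using marked_nested[OF E W] lt by blast
    then show ?thesis using 3 lt dom by (simp add: iff fold_line_def)
  next
    case 4
    have rlt: "r d < r c" "r c < r b" using r_anti[of c d] r_anti[of b c] dom 4 lt by simp_all
    have m: "marked E W a" "(a, r c) \<in> E" "(r b, r d) \<in> E"
      using ac bd lt 4 by (auto simp: iff fold_line_def)
    then have "marked E W (r c)" using meq[of a "r c"] by simp
    then have "(r d, r c) \<in> E"
      using marked_exposed[OF E W _ NCE_sym[OF E m(3)] rlt] by simp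
    then have "(a, r d) \<in> E" using m(2) NCE_eq(2)[OF E, of "r d" "r c" a] by simp
    then have "(a, r b) \<in> E" using NCE_eq(2)[OF E m(3), of a] by simp
    then show ?thesis using 4 lt dom m(1) by (simp add: iff fold_line_def)
  next
    case 5
    have rlt: "r d < r c" "r c < r b" "r b < r a"
      using r_anti[of c d] r_anti[of b c] r_anti[of a b] dom 5 lt by simp_all
    have m: "(r a, r c) \<in> E" "(r b, r d) \<in> E"
      using ac' bd' lt 5 by (simp_all add: fold_line_def)
    have "(r d, r c) \<in> E"
      using NCE_cross[OF E NCE_sym[OF E m(2)] NCE_sym[OF E m(1)] rlt] .
    then have "(r a, r d) \<in> E" using m(1) NCE_eq(2)[OF E, of "r d" "r c" "r a"] by simp
    then have "(r a, r b) \<in> E" using NCE_eq(2)[OF E m(2), of "r a"] by simp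
    then show ?thesis using 5 lt dom by (simp add: iff fold_line_def)
  qed
qed

text \<open>For marked classes the side of a point is immaterial. An unmarked class contains no axis
  point, so \<open>r\<close> moves both ends of a pair to the opposite side and they stay on a
  common side.\<close>

lemma unfold_symmetric:
  assumes E: "E \<in> NCE m" and W: "W \<in> markings E"
  shows "rel_invariant r (unfold_line E W)"
  unfolding rel_invariant_def
proof (intro allI impI)
  fix x y assume xy: "(x, y) \<in> unfold_line E W"
  then have dom: "x \<in> {1..L}" "y \<in> {1..L}" by (simp_all add: unfold_line_iff)
  show "(r x, r y) \<in> unfold_line E W"
  proof (cases "marked E W (fold_line x)")
    case True
    then show ?thesis using xy dom r_closed by (simp add: unfold_line_iff fold_line_r)
  next
    case False
    have side: "r z \<le> m \<longleftrightarrow> \<not> z \<le> m" if z: "z \<in> {1..L}" "\<not> marked E W (fold_line z)" for z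
    proof -
      have "r z \<noteq> z" if "z \<le> m"
        using marked_fixed[OF E W, of z] z that by (auto simp: fold_line_def)
      then show ?thesis using r_lower[of z] r_upper[of z] z by auto
    qed
    have "\<not> marked E W (fold_line y)"
      using False xy marked_eq[OF E, of "fold_line x" "fold_line y"] by (simp add: unfold_line_iff)
    then show ?thesis
      using xy dom r_closed side False by (simp add: unfold_line_iff fold_line_r)
  qed
qed

lemma unfold_restrict:
  assumes "E \<in> NCE m"
  shows "unfold_line E W \<inter> {1..m} \<times> {1..m} = E"
proof (rule Set.set_eqI, clarify)
  fix x y
  show "(x, y) \<in> unfold_line E W \<inter> {1..m} \<times> {1..m} \<longleftrightarrow> (x, y) \<in> E"
    using NCE_dom[OF assms, of x y] m_le by (auto simp: unfold_line_iff fold_line_def)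
qed

text \<open>This recovers W from the unfolded relation. A cut on the axis is its own mirror image
  and thus always selected, consistently with its being forced into W.\<close>

lemma unfold_marks:
  assumes E: "E \<in> NCE m" and W: "W \<in> markings E"
  shows "{x\<in>cuts m E. (x, r x) \<in> unfold_line E W} = W"
proof -
  have sub: "W \<subseteq> cuts m E" using W by (simp add: markings_def)
  have "(x, r x) \<in> unfold_line E W \<longleftrightarrow> x \<in> W" if x: "x \<in> cuts m E" for x
  proof -
    have x': "x \<in> {1..m}" "x \<in> {1..L}" using x cuts_sub[of m E] m_le by auto
    have "(x, r x) \<in> unfold_line E W \<longleftrightarrow> marked E W x \<or> r x \<le> m"
      using x' r_closed[of x] NCE_refl[OF E x'(1)]
      by (simp add: unfold_line_iff fold_line_r) (simp add: fold_line_def)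
    also have "\<dots> \<longleftrightarrow> marked E W x"
      using r_lower[of x] x' marked_fixed[OF E W x'(1)] by auto
    also have "\<dots> \<longleftrightarrow> x \<in> W"
      using cuts_unique[OF E x] sub NCE_refl[OF E x'(1)] by (auto simp: marked_def)
    finally show ?thesis .
  qed
  then show ?thesis using sub by auto
qed

text \<open>The half relation is the restriction of \<open>E\<close>, and the marked cuts are those
  related to their mirror images. What must be shown is that an arc across the axis exists only
  inside a class that is its own mirror image.\<close>

lemma unfold_surj:
  assumes E: "E \<in> NCE L" and sym: "rel_invariant r E"
  obtains E' W where "E' \<in> NCE m" "W \<in> markings E'" "E = unfold_line E' W"
proof -
  define E' where "E' = E \<inter> {1..m} \<times> {1..m}"
  define W where "W = {x\<in>cuts m E'. (x, r x) \<in> E}"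
  have E': "E' \<in> NCE m" unfolding E'_def by (rule restrict_NCE[OF E m_le])
  have in_E': "(x, y) \<in> E' \<longleftrightarrow> x \<in> {1..m} \<and> y \<in> {1..m} \<and> (x, y) \<in> E" for x y
    by (auto simp: E'_def)
  have r_E: "(r x, r y) \<in> E" if "(x, y) \<in> E" for x y
    using sym that by (simp add: rel_invariant_def)
  have W: "W \<in> markings E'"
    unfolding markings_def mem_Collect_eq
  proof
    show "forced E' \<subseteq> W"
    proof
      fix v assume "v \<in> forced E'"
      then obtain p where p: "v \<in> cuts m E'" "r p = p" "(p, v) \<in> E"
        by (auto simp: forced_def in_E')
      then have "(p, r v) \<in> E" using r_E[of p v] by simp
      then have "(v, r v) \<in> E" using NCE_eq(1)[OF E p(3), of "r v"] by simp
      then show "v \<in> W" using p by (simp add: W_def)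
    qed
  qed (auto simp: W_def)
  have marked_iff: "marked E' W x \<longleftrightarrow> (x, r x) \<in> E" if x: "x \<in> {1..m}" for x
  proof
    assume "marked E' W x"
    then obtain w where w: "(w, r w) \<in> E" "(x, w) \<in> E" by (auto simp: marked_def W_def in_E')
    show "(x, r x) \<in> E"
      using w(1) NCE_eq(1)[OF E w(2), of "r w"] NCE_eq(2)[OF E r_E[OF w(2)], of x] by simp
  next
    \<comment> \<open>If x is off the axis, (x, r x) leaves the half and an arc of the half over x
      from another class would cross it. If x is on the axis, it is an end of the half. Either way
      its class has a cut.\<close>
    assume xr: "(x, r x) \<in> E"
    have "(a, x) \<in> E'" if "a < x" "x < c" "(a, c) \<in> E'" for a c
    proof -
      have ac: "a \<in> {1..m}" "c \<in> {1..m}" "(a, c) \<in> E" using that(3) by (simp_all add: in_E')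
      then have "m < r x" using r_lower[of x] x m_le that by auto
      then have "(a, x) \<in> E" using NCE_cross[OF E ac(3) xr that(1,2)] ac(2) by simp
      then show ?thesis using ac x by (simp add: in_E')
    qed
    then obtain w where w: "w \<in> cuts m E'" "(x, w) \<in> E'"
      using class_max_cut[OF E' x] by blast
    have xw: "(x, w) \<in> E" using w by (simp add: in_E')
    have "(w, r w) \<in> E"
      using xr NCE_eq(1)[OF E xw, of "r x"] NCE_eq(2)[OF E r_E[OF xw], of w] by simp
    then show "marked E' W x" using w by (auto simp: marked_def W_def)
  qed
  have across: "(x, y) \<in> E \<longleftrightarrow> (x, y) \<in> unfold_line E' W"
    if x: "x \<in> {1..L}" "x \<le> m" and y: "y \<in> {1..L}" "m < y" for x y
  proof -
    have xm: "x \<in> {1..m}" using x by simp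
    have ry: "r y \<in> {1..m}" "r y \<in> {1..L}" using r_upper[of y] r_closed[of y] y by auto
    have rry: "r (r y) = y" and rrx: "r (r x) = x" using r_invol x y by simp_all
    have "(x, y) \<in> unfold_line E' W \<longleftrightarrow> (x, r y) \<in> E \<and> (x, r x) \<in> E"
      using x y ry xm marked_iff[OF xm] by (auto simp: unfold_line_iff fold_line_def in_E')
    also have "\<dots> \<longleftrightarrow> (x, y) \<in> E"
    proof
      assume *: "(x, r y) \<in> E \<and> (x, r x) \<in> E"
      then have "(r x, y) \<in> E" using r_E[of x "r y"] rry by simp
      then show "(x, y) \<in> E" using * NCE_trans[OF E, of x "r x" y] by simp
    next
      assume xy: "(x, y) \<in> E"
      then have rx: "(r y, r x) \<in> E" using NCE_sym[OF E r_E[OF xy]] by simp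
      \<comment> \<open>The arc (x, y) and its mirror image (r y, r x) either share an end, involve
        an axis point, or cross: in the order x, r y, y, r x or in the order r y, x, r x, y.\<close>
      have "(x, r y) \<in> E"
      proof -
        consider "x = r y" | "r x = x" | "m < r x" "x < r y" | "m < r x" "r y < x"
          using r_lower[OF x] by linarith
        then show ?thesis
        proof cases
          case 1
          then show ?thesis using NCE_refl[OF E x(1)] by simp
        next
          case 2
          then show ?thesis using NCE_sym[OF E rx] by simp
        next
          case 3
          have "y < r x" using r_anti_lower[of x "r y"] x y ry 3 rry by simp
          then show ?thesis using NCE_cross[OF E xy rx] 3 ry y by simp
        next
          case 4
          have "r x < y" using r_anti_lower[of "r y" x] x y ry 4 rry by simp
          then have "(r y, x) \<in> E" using NCE_cross[OF E rx xy] 4 x by simp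
          then show ?thesis by (rule NCE_sym[OF E])
        qed
      qed
      moreover have "(x, r x) \<in> E" using calculation rx NCE_trans[OF E, of x "r y" "r x"] by simp
      ultimately show "(x, r y) \<in> E \<and> (x, r x) \<in> E" by simp
    qed
    finally show ?thesis by simp
  qed
  have eq: "(x, y) \<in> E \<longleftrightarrow> (x, y) \<in> unfold_line E' W" if x: "x \<in> {1..L}" and y: "y \<in> {1..L}" for x y
  proof -
    consider "x \<le> m" "y \<le> m" | "x \<le> m" "m < y" | "m < x" "y \<le> m" | "m < x" "m < y" by linarith
    then show ?thesis
    proof cases
      case 1
      then show ?thesis using x y by (simp add: unfold_line_iff fold_line_def in_E')
    next
      case 2
      then show ?thesis using across x y by simp
    next
      case 3
      then show ?thesis
        using across[of y x] x y NCE_sym_iff[OF E, of x y]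
          NCE_sym_iff[OF unfold_in_NCE[OF E' W], of x y] by simp
    next
      case 4
      have "(x, y) \<in> E \<longleftrightarrow> (r x, r y) \<in> E"
        using r_E[of x y] r_E[of "r x" "r y"] r_invol x y by auto
      then show ?thesis
        using 4 x y r_upper[of x] r_upper[of y] r_closed[of x] r_closed[of y]
        by (simp add: unfold_line_iff fold_line_def in_E')
    qed
  qed
  have "(x, y) \<in> E \<longleftrightarrow> (x, y) \<in> unfold_line E' W" for x y
    using eq[of x y] NCE_dom[OF E, of x y] NCE_dom[OF unfold_in_NCE[OF E' W], of x y] by iprover
  then have "E = unfold_line E' W" by auto
  then show thesis using that[OF E' W] by simp
qed

lemma finite_markings: "finite (markings E)"
  by (rule finite_subset[of _ "Pow (cuts m E)"]) (auto simp: markings_def finite_cuts)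

lemma card_markings: "card (markings E) = 2 ^ (card (cuts m E) - card (forced E))"
proof -
  have sub: "forced E \<subseteq> cuts m E" by (auto simp: forced_def)
  have "bij_betw (\<lambda>W. W - forced E) (markings E) (Pow (cuts m E - forced E))"
    by (rule bij_betw_byWitness[where f' = "\<lambda>W. W \<union> forced E"])
       (use sub in \<open>auto simp: markings_def\<close>)
  then have "card (markings E) = card (Pow (cuts m E - forced E))"
    by (rule bij_betw_same_card)
  also have "\<dots> = 2 ^ card (cuts m E - forced E)"
    by (simp add: card_Pow finite_cuts)
  finally show ?thesis
    using sub finite_subset[OF sub finite_cuts] by (simp add: card_Diff_subset)
qed

text \<open>There are 2^(cuts - forced) markings of each half relation. Expressing the number of
  forced cuts through the number of cuts makes the total a \<open>cut_sum\<close>.\<close>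

lemma card_symmetric:
  assumes "\<And>E. E \<in> NCE m \<Longrightarrow> card (forced E) = f (card (cuts m E))"
  shows "real (card {E\<in>NCE L. rel_invariant r E}) = cut_sum m (\<lambda>k. 2 ^ (k - f k))"
proof -
  let ?S = "SIGMA E:NCE m. markings E"
  have "bij_betw (\<lambda>(E, W). unfold_line E W) ?S {E\<in>NCE L. rel_invariant r E}"
    unfolding bij_betw_def
  proof
    show "inj_on (\<lambda>(E, W). unfold_line E W) ?S"
    proof (rule inj_onI, clarify)
      fix E W E' W'
      assume E: "E \<in> NCE m" "W \<in> markings E" and E': "E' \<in> NCE m" "W' \<in> markings E'"
        and eq: "unfold_line E W = unfold_line E' W'"
      have "E = E'"
        using unfold_restrict[OF E(1), of W] unfold_restrict[OF E'(1), of W'] unfolding eq by simp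
      moreover have "W = W'"
        using unfold_marks[OF E, unfolded eq] unfold_marks[OF E'] \<open>E = E'\<close> by simp
      ultimately show "E = E' \<and> W = W'" ..
    qed
    show "(\<lambda>(E, W). unfold_line E W) ` ?S = {E\<in>NCE L. rel_invariant r E}"
    proof (intro equalityI subsetI)
      fix E assume "E \<in> {E\<in>NCE L. rel_invariant r E}"
      then have "E \<in> NCE L" "rel_invariant r E" by simp_all
      then obtain E' W where "E' \<in> NCE m" "W \<in> markings E'" "E = unfold_line E' W"
        by (rule unfold_surj)
      then show "E \<in> (\<lambda>(E, W). unfold_line E W) ` ?S"
        by (intro image_eqI[of _ _ "(E', W)"]) simp_all
    qed (auto simp: unfold_in_NCE unfold_symmetric)
  qed
  then have "card {E\<in>NCE L. rel_invariant r E} = card ?S"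
    by (simp add: bij_betw_same_card)
  also have "\<dots> = (\<Sum>E\<in>NCE m. card (markings E))"
    by (simp add: finite_NCE finite_markings)
  finally show ?thesis
    using assms by (simp add: card_markings cut_sum_def)
qed

end

section \<open>The three types of reflection axes\<close>

lemma card_sym_no_axis_point:
  assumes r: "\<And>x. x \<in> {1..2 * m} \<Longrightarrow> r x = 2 * m + 1 - x"
  shows "real (card {E\<in>NCE (2 * m). rel_invariant r E}) = real ((2 * m) choose m)"
proof -
  have invol: "r (r x) = x" if "x \<in> {1..2 * m}" for x
  proof -
    have "2 * m + 1 - x \<in> {1..2 * m}" using that by auto
    then show ?thesis using r[OF that] r[of "2 * m + 1 - x"] that by auto
  qed
  interpret line_reflection "2 * m" m r
    by unfold_locales ((rule invol, assumption) | (auto simp: r)[1])+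
  have "r p \<noteq> p" if "p \<in> {1..m}" for p
    using r[of p] that by simp presburger
  then have "forced E = {}" for E by (auto simp: forced_def)
  then show ?thesis
    using card_symmetric[of "\<lambda>_. 0"] by (simp add: cut_sum_pow)
qed

text \<open>The axis meets only the point m, which is the last point of the half and hence always a
  cut. Exactly one class is forced, and the weight is 2^(k - 1).\<close>

lemma card_sym_one_axis_point:
  assumes m: "m \<ge> 1" and r: "\<And>x. x \<in> {1..2 * m - 1} \<Longrightarrow> r x = 2 * m - x"
  shows "real (card {E\<in>NCE (2 * m - 1). rel_invariant r E}) = real ((2 * m) choose m) / 2"
proof -
  have invol: "r (r x) = x" if "x \<in> {1..2 * m - 1}" for x
  proof -
    have "2 * m - x \<in> {1..2 * m - 1}" using that by auto
    then show ?thesis using r[OF that] r[of "2 * m - x"] that by auto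
  qed
  interpret line_reflection "2 * m - 1" m r
    by unfold_locales ((rule invol, assumption) | (use m in \<open>auto simp: r\<close>)[1])+
  have fixed: "r p = p \<longleftrightarrow> p = m" if "p \<in> {1..m}" for p
    using r[of p] that m by (auto, linarith)
  have "forced E = {m}" if E: "E \<in> NCE m" for E
  proof -
    have mm: "m \<in> cuts m E" by (rule last_in_cuts[OF E m])
    then have "v = m" if "v \<in> cuts m E" "(m, v) \<in> E" for v
      using cuts_unique[OF E mm that] by simp
    moreover have "(m, m) \<in> E" using NCE_refl[OF E] m by simp
    ultimately show ?thesis using mm m by (auto simp: forced_def fixed)
  qed
  then show ?thesis
    using card_symmetric[of "\<lambda>_. 1"] cut_sum_pow_minus_1[OF m] by simp
qed

text \<open>The half is {1..Suc m}, with both ends on the axis. The classes of the two ends are the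
  first and the last outer class, which coincide exactly when there is only one outer class.\<close>

lemma card_sym_two_axis_points:
  assumes m: "m \<ge> 1" and r1: "r 1 = 1" and r: "\<And>x. x \<in> {2..2 * m} \<Longrightarrow> r x = 2 * m + 2 - x"
  shows "real (card {E\<in>NCE (2 * m). rel_invariant r E}) = real ((2 * m) choose m)"
proof -
  have r': "r x = (if x = 1 then 1 else 2 * m + 2 - x)" if "x \<in> {1..2 * m}" for x
    using r1 r[of x] that by auto
  have invol: "r (r x) = x" if "x \<in> {1..2 * m}" for x
  proof (cases "x = 1")
    case False
    then have "2 * m + 2 - x \<in> {2..2 * m}" using that by auto
    then show ?thesis using r[of x] r[of "2 * m + 2 - x"] that False by auto
  qed (use r1 in simp)
  interpret line_reflection "2 * m" "Suc m" r
    by unfold_locales ((rule invol, assumption) | (use m in \<open>auto simp: r'\<close>)[1])+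
  have fixed: "r p = p \<longleftrightarrow> p = 1 \<or> p = Suc m" if "p \<in> {1..Suc m}" for p
    using r'[of p] that m by auto
  have "card (forced E) = (if card (cuts (Suc m) E) = 1 then 1 else 2)" if E: "E \<in> NCE (Suc m)" for E
  proof -
    let ?V = "cuts (Suc m) E"
    have last: "Suc m \<in> ?V" by (rule last_in_cuts[OF E]) simp
    have one: "(1::nat) \<in> {1..Suc m}" by simp
    have "(a, 1) \<in> E" if "a < 1" "(1::nat) < c" "(a, c) \<in> E" for a c
      using NCE_dom[OF E that(3)] that(1) by simp
    then obtain v where v: "v \<in> ?V" "(1, v) \<in> E"
      using class_max_cut[OF E one] by blast
    \<comment> \<open>A cut below v would be passed over by the arc (1, v), so the cut v of the
      class of 1 is the least one.\<close>
    have v_le: "v \<le> u" if "u \<in> ?V" for u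
      using cutsD[OF that _ _ v(2)] cuts_sub[of "Suc m" E] that by (intro leI) auto
    have v_uniq: "u = v" if "u \<in> ?V" "(1, u) \<in> E" for u
      using cuts_unique[OF E that(1) v(1)] that(2) v(2) NCE_eq(1)[OF E that(2), of v] by simp
    have last_uniq: "u = Suc m" if "u \<in> ?V" "(Suc m, u) \<in> E" for u
      using cuts_unique[OF E last that] by simp
    have "(Suc m, Suc m) \<in> E" using NCE_refl[OF E] by simp
    note last_last = this
    have forced: "forced E = {v, Suc m}"
    proof (intro equalityI subsetI)
      fix u assume "u \<in> forced E"
      then obtain p where p: "u \<in> ?V" "p \<in> {1..Suc m}" "r p = p" "(p, u) \<in> E"
        by (auto simp: forced_def)
      then have "p = 1 \<or> p = Suc m" using fixed by blast
      then show "u \<in> {v, Suc m}" using v_uniq[OF p(1)] last_uniq[OF p(1)] p(4) by blast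
    next
      fix u assume "u \<in> {v, Suc m}"
      moreover have "r 1 = 1" "r (Suc m) = Suc m" using fixed[of 1] fixed[of "Suc m"] by auto
      ultimately have "u \<in> ?V \<and> ((r 1 = 1 \<and> (1, u) \<in> E) \<or> (r (Suc m) = Suc m \<and> (Suc m, u) \<in> E))"
        using v last last_last by blast
      then show "u \<in> forced E" unfolding forced_def using one by fastforce
    qed
    show ?thesis
    proof (cases "v = Suc m")
      case True
      have "u = Suc m" if "u \<in> ?V" for u
        using v_le[OF that] cuts_sub[of "Suc m" E] that True by auto
      then have "?V = {Suc m}" using last by blast
      then show ?thesis using True forced by simp
    next
      case False
      then have "?V \<noteq> {u}" for u using v last by auto
      then have "card ?V \<noteq> 1" by (auto simp: card_1_singleton_iff)
      then show ?thesis using False forced by simp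
    qed
  qed
  then show ?thesis
    using card_symmetric[of "\<lambda>k. if k = 1 then 1 else 2"] cut_sum_pow_minus_2[of m] by simp
qed

section \<open>The dihedral action on non-crossing partitions\<close>

definition block_rel :: "nat set set \<Rightarrow> (nat \<times> nat) set" where
  "block_rel P = {(x, y). \<exists>B\<in>P. x \<in> B \<and> y \<in> B}"

text \<open>This is \<open>NC_act\<close> without the restriction of its domain, so that composites
  and powers of symmetries obey unconditional identities.\<close>

definition act :: "(nat \<Rightarrow> nat) \<Rightarrow> nat set set \<Rightarrow> nat set set" where
  "act g P = (\<lambda>B. g ` B) ` P"

lemma partition_on_block_unique:
  "partition_on A P \<Longrightarrow> B \<in> P \<Longrightarrow> B' \<in> P \<Longrightarrow> x \<in> B \<Longrightarrow> x \<in> B' \<Longrightarrow> B = B'"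
  unfolding partition_on_def disjoint_def by blast

lemma noncrossing_iff:
  assumes P: "partition_on A P"
  shows "noncrossing P \<longleftrightarrow> noncrossing_rel (block_rel P)"
proof
  assume nc: "noncrossing P"
  show "noncrossing_rel (block_rel P)"
    unfolding noncrossing_rel_def
  proof (intro allI impI, elim conjE)
    fix a b c d :: nat
    assume lt: "a < b" "b < c" "c < d" and rel: "(a, c) \<in> block_rel P" "(b, d) \<in> block_rel P"
    from rel obtain B B' where B: "B \<in> P" "a \<in> B" "c \<in> B" "B' \<in> P" "b \<in> B'" "d \<in> B'"
      unfolding block_rel_def by auto
    have "B = B'"
    proof (rule ccontr)
      assume "B \<noteq> B'"
      then show False using nc B lt unfolding noncrossing_def by blast
    qed
    then show "(a, b) \<in> block_rel P" using B unfolding block_rel_def by auto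
  qed
next
  assume nc: "noncrossing_rel (block_rel P)"
  show "noncrossing P"
    unfolding noncrossing_def
  proof (rule notI, elim exE bexE conjE)
    fix a b c d :: nat and B B'
    assume B: "B \<in> P" "B' \<in> P" "B \<noteq> B'" "a \<in> B" "c \<in> B" "b \<in> B'" "d \<in> B'"
      and lt: "a < b" "b < c" "c < d"
    have "(a, c) \<in> block_rel P" "(b, d) \<in> block_rel P" using B by (auto simp: block_rel_def)
    then have "(a, b) \<in> block_rel P"
      using nc[unfolded noncrossing_rel_def, rule_format, of a b c d] lt by simp
    then obtain B'' where "B'' \<in> P" "a \<in> B''" "b \<in> B''" by (auto simp: block_rel_def)
    then have "B = B''" "B' = B''"
      using B partition_on_block_unique[OF P] by blast+
    then show False using B by simp
  qed
qed

lemma NC_iff: "P \<in> NC L \<longleftrightarrow> partition_on {1..L} P \<and> block_rel P \<in> NCE L"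
  using noncrossing_iff[of "{1..L}" P] equiv_partition_on[of "{1..L}" P]
  by (auto simp: NC_def NCE_def block_rel_def)

lemma block_rel_inj: "inj_on block_rel (NC L)"
proof (rule inj_onI)
  fix P Q assume "P \<in> NC L" "Q \<in> NC L" "block_rel P = block_rel Q"
  then show "P = Q"
    using partition_on_eq_quotient[of "{1..L}" P] partition_on_eq_quotient[of "{1..L}" Q]
    by (simp add: NC_iff block_rel_def)
qed

lemma block_rel_surj: "block_rel ` NC L = NCE L"
proof (intro equalityI subsetI)
  fix E assume E: "E \<in> NCE L"
  have eq: "equiv {1..L} E" using E by (rule NCE_equiv)
  have "block_rel ({1..L} // E) = E"
  proof (rule Set.set_eqI, clarify)
    fix x y
    show "(x, y) \<in> block_rel ({1..L} // E) \<longleftrightarrow> (x, y) \<in> E"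
    proof
      assume "(x, y) \<in> block_rel ({1..L} // E)"
      then show "(x, y) \<in> E"
        using in_quotient_imp_in_rel[OF eq] by (auto simp: block_rel_def)
    next
      assume xy: "(x, y) \<in> E"
      have x: "x \<in> {1..L}" using NCE_dom[OF E xy] by simp
      then show "(x, y) \<in> block_rel ({1..L} // E)"
        using NCE_refl[OF E x] xy quotientI[OF x, of E] unfolding block_rel_def by blast
    qed
  qed
  then show "E \<in> block_rel ` NC L"
    using partition_on_quotient[OF eq] E by (intro image_eqI[of _ _ "{1..L} // E"]) (simp_all add: NC_iff)
qed (auto simp: NC_iff)

lemma finite_NC: "finite (NC L)"
  by (rule finite_subset[of _ "{P. partition_on {1..L} P}"])
     (auto simp: NC_def intro: finitely_many_partition_on)

lemma NC_blocks: "P \<in> NC L \<Longrightarrow> B \<in> P \<Longrightarrow> B \<subseteq> {1..L}"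
  using partition_onD1[of "{1..L}" P] by (auto simp: NC_def)

lemma act_act: "act g (act h P) = act (\<lambda>x. g (h x)) P"
  by (simp add: act_def image_image)

lemma act_cong: "P \<in> NC L \<Longrightarrow> (\<And>x. x \<in> {1..L} \<Longrightarrow> g x = h x) \<Longrightarrow> act g P = act h P"
  unfolding act_def using NC_blocks by (intro image_cong refl) blast

lemma act_id: "P \<in> NC L \<Longrightarrow> (\<And>x. x \<in> {1..L} \<Longrightarrow> g x = x) \<Longrightarrow> act g P = P"
  using act_cong[of P L g id] by (simp add: act_def)

lemma act_funpow: "(act g ^^ k) P = act (g ^^ k) P"
  by (induction k) (simp_all add: act_act, simp_all add: act_def)

lemma block_rel_act: "block_rel (act g P) = map_prod g g ` block_rel P"
  by (auto simp: block_rel_def act_def)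

text \<open>
  The inverse \<open>q\<close> of a symmetry need not preserve the order of \<open>a < b < c < d\<close>, only their cyclic
  order up to reversal, hence the form of the crossing condition.
\<close>

lemma act_in_NC:
  assumes P: "P \<in> NC L" and g: "bij_betw g {1..L} {1..L}"
    and inv: "\<And>x. x \<in> {1..L} \<Longrightarrow> q (g x) = x"
    and cross: "\<And>a b c d E. E \<in> NCE L \<Longrightarrow> {a, b, c, d} \<subseteq> {1..L} \<Longrightarrow> a < b \<Longrightarrow> b < c \<Longrightarrow> c < d \<Longrightarrow>
      (q a, q c) \<in> E \<Longrightarrow> (q b, q d) \<in> E \<Longrightarrow> (q a, q b) \<in> E"
  shows "act g P \<in> NC L"
proof -
  have part: "partition_on {1..L} P" and E: "block_rel P \<in> NCE L" using P by (simp_all add: NC_iff)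
  have "partition_on (g ` {1..L}) ((`) g ` P - {{}})"
    using g by (intro partition_on_inj_image[OF part]) (simp add: bij_betw_def)
  moreover have "(`) g ` P - {{}} = act g P"
    using partition_onD3[OF part] by (auto simp: act_def)
  ultimately have part': "partition_on {1..L} (act g P)"
    using g by (simp add: bij_betw_def)
  have rel: "(q x, q y) \<in> block_rel P \<and> x \<in> {1..L} \<and> y \<in> {1..L}" if xy: "(x, y) \<in> block_rel (act g P)" for x y
  proof -
    obtain x' y' where "(x', y') \<in> block_rel P" "x = g x'" "y = g y'"
      using xy unfolding block_rel_act by auto
    then show ?thesis
      using NCE_dom[OF E, of x' y'] inv[of x'] inv[of y'] bij_betwE[OF g] by simp
  qed
  have rel': "(x, y) \<in> block_rel (act g P)"
    if "(q x, q y) \<in> block_rel P" "x \<in> {1..L}" "y \<in> {1..L}" for x y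
  proof -
    \<comment> \<open>Surjectivity of \<open>g\<close> makes the left inverse \<open>q\<close> a
      right inverse as well.\<close>
    have "g (q z) = z" if "z \<in> {1..L}" for z
    proof -
      obtain z' where "z' \<in> {1..L}" "z = g z'" using g \<open>z \<in> {1..L}\<close> unfolding bij_betw_def by (metis imageE)
      then show ?thesis using inv[of z'] by simp
    qed
    then have "(x, y) = map_prod g g (q x, q y)" using that by simp
    then show ?thesis unfolding block_rel_act using that(1) by blast
  qed
  have "noncrossing_rel (block_rel (act g P))"
    unfolding noncrossing_rel_def
  proof (intro allI impI, elim conjE)
    fix a b c d :: nat
    assume lt: "a < b" "b < c" "c < d"
      and ac: "(a, c) \<in> block_rel (act g P)" and bd: "(b, d) \<in> block_rel (act g P)"
    have "(q a, q b) \<in> block_rel P"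
      using rel[OF ac] rel[OF bd] by (intro cross[OF E _ lt]) auto
    then show "(a, b) \<in> block_rel (act g P)"
      using rel[OF ac] rel[OF bd] by (intro rel') simp_all
  qed
  then show ?thesis
    using part' noncrossing_iff[OF part'] by (simp add: NC_def)
qed

section \<open>Dihedral relations on points and on partitions\<close>

lemma rotation_eq: "x \<in> {1..L} \<Longrightarrow> rotation L x = (if x = L then 1 else x + 1)"
  by (auto simp: rotation_def)

lemma reflection_eq: "x \<in> {1..L} \<Longrightarrow> reflection L x = L + 1 - x"
  by (simp add: reflection_def)

lemma rotation_bij: "bij_betw (rotation L) {1..L} {1..L}"
  using rotation_in_Bij[of L] by (simp add: BijGroup_def Bij_def)

lemma reflection_bij: "bij_betw (reflection L) {1..L} {1..L}"
  using reflection_in_Bij[of L] by (simp add: BijGroup_def Bij_def)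

lemma rotation_pow:
  assumes "x \<in> {1..L}"
  shows "(rotation L ^^ k) x = (x - 1 + k) mod L + 1"
proof (induction k)
  case 0
  then show ?case using assms by auto
next
  case (Suc k)
  have "(rotation L ^^ Suc k) x = rotation L ((x - 1 + k) mod L + 1)"
    using Suc by simp
  also have "\<dots> = ((x - 1 + k) mod L + 1) mod L + 1"
    using assms mod_less_divisor[of L "x - 1 + k"] by (simp add: rotation_def Suc_le_eq)
  also have "\<dots> = (x - 1 + Suc k) mod L + 1"
    by (simp add: mod_Suc_eq)
  finally show ?case .
qed

lemma dihedral_points: "L \<ge> 1 \<Longrightarrow> dihedral_action {1..L} (rotation L) (reflection L) L"
proof
  fix x assume L: "L \<ge> 1" and x: "x \<in> {1..L}"
  show "rotation L x \<in> {1..L}" "reflection L x \<in> {1..L}"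
    using x bij_betwE[OF rotation_bij] bij_betwE[OF reflection_bij] by blast+
  have "(x - 1 + L) mod L = x - 1" using x by (simp only: mod_add_self2) auto
  then show "(rotation L ^^ L) x = x" using x by (simp only: rotation_pow) auto
  show "reflection L (reflection L x) = x"
  proof -
    have "L + 1 - x \<in> {1..L}" using x by auto
    then show ?thesis using x by (simp add: reflection_eq)
  qed
  show "rotation L (reflection L (rotation L x)) = reflection L x"
  proof (cases "x = L")
    case True
    then show ?thesis using x by (simp add: rotation_eq reflection_eq)
  next
    case False
    then have "x + 1 \<in> {1..L}" "L - x \<in> {1..L}" "L - x \<noteq> L" using x by auto
    then show ?thesis using x False by (simp add: rotation_eq reflection_eq)
  qed
qed auto

lemma act_reflection_in_NC: "P \<in> NC L \<Longrightarrow> act (reflection L) P \<in> NC L"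
proof (rule act_in_NC[OF _ reflection_bij, where q = "reflection L"])
  fix x assume "x \<in> {1..L}"
  then show "reflection L (reflection L x) = x"
    using dihedral_action.T_invol[OF dihedral_points] by auto
next
  fix a b c d :: nat and E
  assume E: "E \<in> NCE L" and dom: "{a, b, c, d} \<subseteq> {1..L}" and lt: "a < b" "b < c" "c < d"
    and ac: "(reflection L a, reflection L c) \<in> E" and bd: "(reflection L b, reflection L d) \<in> E"
  let ?q = "reflection L"
  \<comment> \<open>Reflection reverses the order, so non-crossing relates the images of d and c;
    the given pairs then carry this over to a and b.\<close>
  have "?q d < ?q c" "?q c < ?q b" "?q b < ?q a" using dom lt by (auto simp: reflection_eq)
  then have "(?q d, ?q c) \<in> E" using NCE_cross[OF E NCE_sym[OF E bd] NCE_sym[OF E ac]] by simp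
  then show "(?q a, ?q b) \<in> E"
    using ac NCE_eq(2)[OF E, of "?q d" "?q c" "?q a"] NCE_eq(2)[OF E bd, of "?q a"] by simp
qed

lemma act_rotation_in_NC: "P \<in> NC L \<Longrightarrow> act (rotation L) P \<in> NC L"
proof (rule act_in_NC[OF _ rotation_bij, where q = "\<lambda>x. if x = 1 then L else x - 1"])
  fix x assume "x \<in> {1..L}"
  then show "(if rotation L x = 1 then L else rotation L x - 1) = x"
    by (auto simp: rotation_eq)
next
  fix a b c d :: nat and E
  assume E: "E \<in> NCE L" and dom: "{a, b, c, d} \<subseteq> {1..L}" and lt: "a < b" "b < c" "c < d"
    and ac: "(if a = 1 then L else a - 1, if c = 1 then L else c - 1) \<in> E"
    and bd: "(if b = 1 then L else b - 1, if d = 1 then L else d - 1) \<in> E"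
  have bd': "(b - 1, d - 1) \<in> E" using bd dom lt by auto
  show "(if a = 1 then L else a - 1, if b = 1 then L else b - 1) \<in> E"
  \<comment> \<open>Only a = 1 wraps around. Its preimage is L, so the order becomes b - 1 < c - 1 <
    d - 1 < L, and the two arcs still cross with their roles exchanged.\<close>
  proof (cases "a = 1")
    case True
    have Lc: "(L, c - 1) \<in> E" using ac True dom lt by auto
    have "(b - 1, c - 1) \<in> E"
      by (rule NCE_cross[OF E bd' NCE_sym[OF E Lc]]) (use dom lt True in auto)
    then have "(L, b - 1) \<in> E" using Lc NCE_eq(2)[OF E, of "b - 1" "c - 1" L] by simp
    then show ?thesis using True lt by simp
  next
    case False
    then have ac': "(a - 1, c - 1) \<in> E" using ac dom lt by auto
    have "(a - 1, b - 1) \<in> E"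
      by (rule NCE_cross[OF E ac' bd']) (use dom lt False in auto)
    then show ?thesis using False lt dom by auto
  qed
qed

lemma dihedral_NC:
  assumes L: "L \<ge> 1"
  shows "dihedral_action (NC L) (act (rotation L)) (act (reflection L)) L"
proof
  interpret pt: dihedral_action "{1..L}" "rotation L" "reflection L" L
    by (rule dihedral_points[OF L])
  fix P assume P: "P \<in> NC L"
  show "act (rotation L) P \<in> NC L" "act (reflection L) P \<in> NC L"
    using P by (simp_all add: act_rotation_in_NC act_reflection_in_NC)
  show "(act (rotation L) ^^ L) P = P"
    unfolding act_funpow by (rule act_id[OF P pt.R_period])
  show "act (reflection L) (act (reflection L) P) = P"
    unfolding act_act by (rule act_id[OF P pt.T_invol])
  show "act (rotation L) (act (reflection L) (act (rotation L) P)) = act (reflection L) P"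
    unfolding act_act by (rule act_cong[OF P pt.RTR])
qed (use L finite_NC in auto)

section \<open>Elements of the generated permutation groups\<close>

lemma mult_BijGroup:
  "g \<in> carrier (BijGroup S) \<Longrightarrow> h \<in> carrier (BijGroup S) \<Longrightarrow> x \<in> S \<Longrightarrow>
    (g \<otimes>\<^bsub>BijGroup S\<^esub> h) x = g (h x)"
  by (simp add: BijGroup_def compose_def)

lemma one_BijGroup: "x \<in> S \<Longrightarrow> \<one>\<^bsub>BijGroup S\<^esub> x = x"
  by (simp add: BijGroup_def)

lemma inv_BijGroup:
  assumes g: "g \<in> carrier (BijGroup S)" and x: "x \<in> S"
  shows "(inv\<^bsub>BijGroup S\<^esub> g) (g x) = x"
proof -
  interpret group "BijGroup S" by (rule group_BijGroup)
  have "(inv\<^bsub>BijGroup S\<^esub> g) (g x) = (inv\<^bsub>BijGroup S\<^esub> g \<otimes>\<^bsub>BijGroup S\<^esub> g) x"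
    by (rule mult_BijGroup[OF inv_closed[OF g] g x, symmetric])
  also have "\<dots> = x" unfolding l_inv[OF g] by (rule one_BijGroup[OF x])
  finally show ?thesis .
qed

lemma carrier_rotation_group:
  "carrier (rotation_group L) = generate (BijGroup {1..L}) {rotation L}"
  using rotation_in_Bij by (simp add: rotation_group_def carrier_subgroup_generated Int_absorb1)

lemma carrier_rotation_reflection_group:
  "carrier (rotation_reflection_group L) = generate (BijGroup {1..L}) {rotation L, reflection L}"
  using rotation_in_Bij reflection_in_Bij
  by (simp add: rotation_reflection_group_def carrier_subgroup_generated Int_absorb1)

text \<open>Agreement is asserted only on {1..L}: group elements are extensional functions, whereas
  the zeroth power of \<open>rotation L\<close> is the identity everywhere.\<close>

lemma rotation_pow_generated:
  assumes "rotation L \<in> H" "H \<subseteq> carrier (BijGroup {1..L})"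
  shows "\<exists>g\<in>generate (BijGroup {1..L}) H. \<forall>x\<in>{1..L}. g x = (rotation L ^^ k) x"
proof (induction k)
  case 0
  show ?case
    by (rule bexI[OF _ generate.one]) (simp add: one_BijGroup)
next
  case (Suc k)
  then obtain g where g: "g \<in> generate (BijGroup {1..L}) H" "\<forall>x\<in>{1..L}. g x = (rotation L ^^ k) x"
    by blast
  have "g \<in> carrier (BijGroup {1..L})"
    using group.generate_in_carrier[OF group_BijGroup assms(2) g(1)] .
  then have "\<forall>x\<in>{1..L}. (rotation L \<otimes>\<^bsub>BijGroup {1..L}\<^esub> g) x = (rotation L ^^ Suc k) x"
    using g(2) rotation_in_Bij by (simp add: mult_BijGroup)
  then show ?case
    using generate.eng[OF generate.incl[OF assms(1)] g(1)] by blast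
qed

lemma rotation_pow_reflection_generated:
  assumes "rotation L \<in> H" "reflection L \<in> H" "H \<subseteq> carrier (BijGroup {1..L})"
  shows "\<exists>g\<in>generate (BijGroup {1..L}) H. \<forall>x\<in>{1..L}. g x = (rotation L ^^ k) (reflection L x)"
proof -
  obtain g where g: "g \<in> generate (BijGroup {1..L}) H" "\<forall>x\<in>{1..L}. g x = (rotation L ^^ k) x"
    using rotation_pow_generated[OF assms(1,3)] by blast
  have "g \<in> carrier (BijGroup {1..L})"
    using group.generate_in_carrier[OF group_BijGroup assms(3) g(1)] .
  then have "\<forall>x\<in>{1..L}. (g \<otimes>\<^bsub>BijGroup {1..L}\<^esub> reflection L) x = (rotation L ^^ k) (reflection L x)"
    using g(2) reflection_in_Bij bij_betwE[OF reflection_bij] by (simp add: mult_BijGroup)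
  then show ?thesis
    using generate.eng[OF g(1) generate.incl[OF assms(2)]] by blast
qed

text \<open>\<open>generate\<close> admits inverses of generators; rewriting this one as a natural
  power keeps the normal forms R^k and R^k T free of negative exponents.\<close>

lemma inv_rotation:
  assumes x: "x \<in> {1..L}"
  shows "(inv\<^bsub>BijGroup {1..L}\<^esub> rotation L) x = (rotation L ^^ (L - 1)) x"
proof -
  have L: "L \<ge> 1" using x by simp
  interpret pt: dihedral_action "{1..L}" "rotation L" "reflection L" L
    by (rule dihedral_points[OF L])
  have "rotation L ((rotation L ^^ (L - 1)) x) = x"
    using pt.R_period[OF x] L by (cases L) simp_all
  then show ?thesis
    using inv_BijGroup[OF rotation_in_Bij pt.Rpow_closed[OF x], of "L - 1"] by simp
qed

lemma inv_reflection:
  assumes x: "x \<in> {1..L}"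
  shows "(inv\<^bsub>BijGroup {1..L}\<^esub> reflection L) x = reflection L x"
proof -
  have L: "L \<ge> 1" using x by simp
  interpret pt: dihedral_action "{1..L}" "rotation L" "reflection L" L
    by (rule dihedral_points[OF L])
  show ?thesis
    using inv_BijGroup[OF reflection_in_Bij pt.T_closed[OF x]] by (simp add: pt.T_invol[OF x])
qed

lemma rotation_group_elem:
  assumes "g \<in> generate (BijGroup {1..L}) {rotation L}"
  shows "\<exists>k. \<forall>x\<in>{1..L}. g x = (rotation L ^^ k) x"
  using assms
proof (induction rule: generate.induct)
  case one
  show ?case by (rule exI[of _ 0]) (simp add: one_BijGroup)
next
  case (incl h)
  then show ?case by (intro exI[of _ 1]) simp
next
  case (inv h)
  then show ?case using inv_rotation by blast
next
  case (eng g h)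
  then obtain j k where jk: "\<forall>x\<in>{1..L}. g x = (rotation L ^^ j) x" "\<forall>x\<in>{1..L}. h x = (rotation L ^^ k) x"
    by blast
  have sub: "{rotation L} \<subseteq> carrier (BijGroup {1..L})" using rotation_in_Bij by simp
  note car = group.generate_in_carrier[OF group_BijGroup sub]
  have "(g \<otimes>\<^bsub>BijGroup {1..L}\<^esub> h) x = (rotation L ^^ (j + k)) x" if x: "x \<in> {1..L}" for x
  proof -
    interpret pt: dihedral_action "{1..L}" "rotation L" "reflection L" L
      by (rule dihedral_points) (use x in simp)
    show ?thesis
      using jk x pt.Rpow_closed[OF x, of k] eng.hyps
      by (simp add: mult_BijGroup car pt.Rpow_Rpow del: One_nat_def atLeastAtMost_iff)
  qed
  then show ?case by blast
qed

text \<open>The normal form R^k or R^k T survives products because T R^k = R^(-k) T, with -k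
  represented by \<open>L * k - k\<close>. For L = 0 the circuit has no points and the claim is
  vacuous.\<close>

lemma rotation_reflection_group_elem:
  assumes "g \<in> generate (BijGroup {1..L}) {rotation L, reflection L}"
  shows "\<exists>k. (\<forall>x\<in>{1..L}. g x = (rotation L ^^ k) x) \<or>
    (\<forall>x\<in>{1..L}. g x = (rotation L ^^ k) (reflection L x))"
  using assms
proof (induction rule: generate.induct)
  case one
  show ?case by (intro exI[of _ 0] disjI1) (simp add: one_BijGroup)
next
  case (incl h)
  then have "h = rotation L \<or> h = reflection L" by simp
  then show ?case
  proof
    assume "h = rotation L"
    then show ?thesis by (intro exI[of _ 1] disjI1) simp
  next
    assume "h = reflection L"
    then show ?thesis by (intro exI[of _ 0] disjI2) simp
  qed
next
  case (inv h)
  then have "h = rotation L \<or> h = reflection L" by simp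
  then show ?case
  proof
    assume "h = rotation L"
    then show ?thesis by (intro exI[of _ "L - 1"] disjI1) (simp add: inv_rotation del: One_nat_def atLeastAtMost_iff)
  next
    assume "h = reflection L"
    then show ?thesis by (intro exI[of _ 0] disjI2) (simp add: inv_reflection del: One_nat_def atLeastAtMost_iff)
  qed
next
  case (eng g h)
  show ?case
  proof (cases "L \<ge> 1")
    case True
    interpret pt: dihedral_action "{1..L}" "rotation L" "reflection L" L
      by (rule dihedral_points[OF True])
    have sub: "{rotation L, reflection L} \<subseteq> carrier (BijGroup {1..L})"
      using rotation_in_Bij reflection_in_Bij by simp
    note car = group.generate_in_carrier[OF group_BijGroup sub]
    have mult: "(g \<otimes>\<^bsub>BijGroup {1..L}\<^esub> h) x = g (h x)" if "x \<in> {1..L}" for x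
      using that eng.hyps
      by (simp add: mult_BijGroup car del: One_nat_def atLeastAtMost_iff)
    from eng.IH obtain j k where
      g: "(\<forall>x\<in>{1..L}. g x = (rotation L ^^ j) x) \<or> (\<forall>x\<in>{1..L}. g x = (rotation L ^^ j) (reflection L x))" and
      h: "(\<forall>x\<in>{1..L}. h x = (rotation L ^^ k) x) \<or> (\<forall>x\<in>{1..L}. h x = (rotation L ^^ k) (reflection L x))"
      by blast
    note cl = pt.Rpow_closed pt.T_closed
    from g h show ?thesis
    proof (elim disjE)
      assume "\<forall>x\<in>{1..L}. g x = (rotation L ^^ j) x" "\<forall>x\<in>{1..L}. h x = (rotation L ^^ k) x"
      then show ?thesis
        by (intro exI[of _ "j + k"] disjI1) (simp add: mult cl pt.Rpow_Rpow del: One_nat_def atLeastAtMost_iff)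
    next
      assume "\<forall>x\<in>{1..L}. g x = (rotation L ^^ j) x" "\<forall>x\<in>{1..L}. h x = (rotation L ^^ k) (reflection L x)"
      then show ?thesis
        by (intro exI[of _ "j + k"] disjI2) (simp add: mult cl pt.Rpow_Rpow del: One_nat_def atLeastAtMost_iff)
    next
      assume "\<forall>x\<in>{1..L}. g x = (rotation L ^^ j) (reflection L x)" "\<forall>x\<in>{1..L}. h x = (rotation L ^^ k) x"
      then show ?thesis
        by (intro exI[of _ "j + (L * k - k)"] disjI2)
           (simp add: mult cl pt.Rpow_Rpow pt.T_Rpow del: One_nat_def atLeastAtMost_iff)
    next
      assume "\<forall>x\<in>{1..L}. g x = (rotation L ^^ j) (reflection L x)"
        "\<forall>x\<in>{1..L}. h x = (rotation L ^^ k) (reflection L x)"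
      then show ?thesis
        by (intro exI[of _ "j + (L * k - k)"] disjI1)
           (simp add: mult cl pt.Rpow_Rpow pt.T_Rpow pt.T_invol del: One_nat_def atLeastAtMost_iff)
    qed
  qed simp
qed

section \<open>Fixed partitions as invariant relations\<close>

lemma act_fixed_iff:
  assumes P: "P \<in> NC L" and closed: "act g P \<in> NC L" and g: "inj_on g {1..L}"
  shows "act g P = P \<longleftrightarrow> rel_invariant g (block_rel P)"
proof -
  have E: "block_rel P \<in> NCE L" using P by (simp add: NC_iff)
  have sub: "block_rel P \<subseteq> {1..L} \<times> {1..L}" using equiv_type[OF NCE_equiv[OF E]] .
  have "act g P = P \<longleftrightarrow> block_rel (act g P) = block_rel P"
    using inj_on_eq_iff[OF block_rel_inj closed P] by simp
  also have "\<dots> \<longleftrightarrow> map_prod g g ` block_rel P = block_rel P"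
    by (simp add: block_rel_act)
  also have "\<dots> \<longleftrightarrow> map_prod g g ` block_rel P \<subseteq> block_rel P"
  proof
    \<comment> \<open>An injective map of a finite set into itself is onto, so inclusion of the
      image gives equality.\<close>
    assume *: "map_prod g g ` block_rel P \<subseteq> block_rel P"
    have "inj_on (map_prod g g) (block_rel P)"
      using map_prod_inj_on[OF g g] sub by (rule inj_on_subset)
    then show "map_prod g g ` block_rel P = block_rel P"
      using endo_inj_surj[OF _ *] finite_subset[OF sub] by blast
  qed simp
  also have "\<dots> \<longleftrightarrow> rel_invariant g (block_rel P)"
    by (auto simp: rel_invariant_def)
  finally show ?thesis .
qed

lemma card_act_fixed:
  assumes "\<And>P. P \<in> NC L \<Longrightarrow> act g P \<in> NC L" and "inj_on g {1..L}"
  shows "card {P\<in>NC L. act g P = P} = card {E\<in>NCE L. rel_invariant g E}"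
proof (rule bij_betw_same_card[of block_rel])
  have "block_rel ` {P\<in>NC L. act g P = P} = {E\<in>NCE L. rel_invariant g E}"
    unfolding block_rel_surj[symmetric] using act_fixed_iff[OF _ assms(1) assms(2)] by auto
  moreover have "inj_on block_rel {P\<in>NC L. act g P = P}"
    by (rule inj_on_subset[OF block_rel_inj]) auto
  ultimately show "bij_betw block_rel {P\<in>NC L. act g P = P} {E\<in>NCE L. rel_invariant g E}"
    by (simp add: bij_betw_def)
qed

section \<open>Group orbits in terms of powers of the rotation\<close>

lemma NC_act_eq: "P \<in> NC L \<Longrightarrow> NC_act L g P = act g P"
  by (simp add: NC_act_def act_def)

lemma orbit_rotation_group:
  assumes P: "P \<in> NC L"
  shows "orbit (rotation_group L) (NC_act L) P = range (\<lambda>k. (act (rotation L) ^^ k) P)"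
proof (intro equalityI subsetI)
  fix Q assume "Q \<in> orbit (rotation_group L) (NC_act L) P"
  then obtain g where g: "g \<in> generate (BijGroup {1..L}) {rotation L}" "Q = act g P"
    by (auto simp: orbit_def carrier_rotation_group NC_act_eq[OF P])
  then obtain k where "\<And>x. x \<in> {1..L} \<Longrightarrow> g x = (rotation L ^^ k) x"
    using rotation_group_elem by blast
  then have "Q = (act (rotation L) ^^ k) P"
    unfolding g(2) act_funpow by (rule act_cong[OF P])
  then show "Q \<in> range (\<lambda>k. (act (rotation L) ^^ k) P)" by blast
next
  fix Q assume "Q \<in> range (\<lambda>k. (act (rotation L) ^^ k) P)"
  then obtain k where k: "Q = act (rotation L ^^ k) P" by (auto simp: act_funpow)
  obtain g where g: "g \<in> generate (BijGroup {1..L}) {rotation L}"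
      "\<And>x. x \<in> {1..L} \<Longrightarrow> g x = (rotation L ^^ k) x"
    using rotation_pow_generated[of L "{rotation L}" k] rotation_in_Bij by blast
  have "Q = NC_act L g P"
    unfolding k NC_act_eq[OF P] using act_cong[OF P g(2)] by simp
  then show "Q \<in> orbit (rotation_group L) (NC_act L) P"
    using g(1) by (auto simp: orbit_def carrier_rotation_group)
qed

lemma orbit_rotation_reflection_group:
  assumes P: "P \<in> NC L"
  shows "orbit (rotation_reflection_group L) (NC_act L) P =
    range (\<lambda>k. (act (rotation L) ^^ k) P) \<union> range (\<lambda>k. (act (rotation L) ^^ k) (act (reflection L) P))"
    (is "_ = ?A \<union> ?B")
proof (intro equalityI subsetI)
  fix Q assume "Q \<in> orbit (rotation_reflection_group L) (NC_act L) P"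
  then obtain g where g: "g \<in> generate (BijGroup {1..L}) {rotation L, reflection L}" "Q = act g P"
    by (auto simp: orbit_def carrier_rotation_reflection_group NC_act_eq[OF P])
  obtain k where "(\<forall>x\<in>{1..L}. g x = (rotation L ^^ k) x) \<or>
      (\<forall>x\<in>{1..L}. g x = (rotation L ^^ k) (reflection L x))"
    using rotation_reflection_group_elem[OF g(1)] by blast
  then show "Q \<in> ?A \<union> ?B"
  proof
    assume "\<forall>x\<in>{1..L}. g x = (rotation L ^^ k) x"
    then have "Q = (act (rotation L) ^^ k) P"
      unfolding g(2) act_funpow by (intro act_cong[OF P]) blast
    then show ?thesis by blast
  next
    assume "\<forall>x\<in>{1..L}. g x = (rotation L ^^ k) (reflection L x)"
    then have "Q = (act (rotation L) ^^ k) (act (reflection L) P)"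
      unfolding g(2) act_funpow act_act by (intro act_cong[OF P]) blast
    then show ?thesis by blast
  qed
next
  have sub: "{rotation L, reflection L} \<subseteq> carrier (BijGroup {1..L})"
    using rotation_in_Bij reflection_in_Bij by simp
  fix Q assume "Q \<in> ?A \<union> ?B"
  then obtain k f where Q: "Q = act f P"
    and f: "f = (rotation L ^^ k) \<or> f = (\<lambda>x. (rotation L ^^ k) (reflection L x))"
    by (auto simp: act_funpow act_act)
  have "\<exists>g\<in>generate (BijGroup {1..L}) {rotation L, reflection L}. \<forall>x\<in>{1..L}. g x = f x"
    using f
  proof
    assume f: "f = (rotation L ^^ k)"
    show ?thesis unfolding f by (rule rotation_pow_generated[OF _ sub]) simp
  next
    assume f: "f = (\<lambda>x. (rotation L ^^ k) (reflection L x))"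
    show ?thesis unfolding f by (rule rotation_pow_reflection_generated[OF _ _ sub]) simp_all
  qed
  then obtain g where g: "g \<in> generate (BijGroup {1..L}) {rotation L, reflection L}"
      "\<And>x. x \<in> {1..L} \<Longrightarrow> g x = f x"
    by blast
  have "Q = NC_act L g P"
    unfolding Q NC_act_eq[OF P] using act_cong[OF P g(2)] by simp
  then show "Q \<in> orbit (rotation_reflection_group L) (NC_act L) P"
    using g(1) by (auto simp: orbit_def carrier_rotation_reflection_group)
qed

section \<open>Averaging the fixed partitions over all reflections\<close>

theorem theorem2p1:
  fixes L :: nat
  assumes "L \<ge> 1"
  shows "2 * real (N_Z_sq_PF L) - real (N_Z_tri_PF L) =
    (if even L then real (N_Z_sqtri_FP (L div 2))
     else (1 / 2) * real (N_Z_sqtri_FP ((L + 1) div 2)))"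
proof -
  let ?R = "act (rotation L)" and ?T = "act (reflection L)"
  interpret D: dihedral_action "NC L" ?R ?T L
    by (rule dihedral_NC[OF assms])
  have orbits: "orbits G X \<phi> = orbit G \<phi> ` X" for G :: "(nat \<Rightarrow> nat) monoid" and X :: "nat set set set" and \<phi>
    by (auto simp: orbits_def)
  have "orbits (rotation_group L) (NC L) (NC_act L) = D.rot_orbit ` NC L"
    unfolding orbits D.rot_orbit_def by (rule image_cong[OF refl orbit_rotation_group])
  moreover have "orbits (rotation_reflection_group L) (NC L) (NC_act L) = D.full_orbit ` NC L"
    unfolding orbits D.full_orbit_def D.rot_orbit_def
    by (rule image_cong[OF refl orbit_rotation_reflection_group])
  ultimately have lhs: "2 * real (N_Z_sq_PF L) - real (N_Z_tri_PF L) =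
      (\<Sum>k<L. real (card {P\<in>NC L. (?R ^^ k) (?T P) = P})) / real L"
    unfolding N_Z_sq_PF_def N_Z_tri_PF_def by (simp only: D.twice_full_minus_rot)
  \<comment> \<open>All L reflections will turn out to fix the same number of partitions, so their
    average is that number.\<close>
  have avg: "2 * real (N_Z_sq_PF L) - real (N_Z_tri_PF L) = c"
    if "\<And>k. real (card {P\<in>NC L. (?R ^^ k) (?T P) = P}) = c" for c
    unfolding lhs that using assms by simp
  have fix_T: "card {P\<in>NC L. ?T P = P} = card {E\<in>NCE L. rel_invariant (reflection L) E}"
    by (rule card_act_fixed) (use D.T_closed reflection_bij in \<open>auto simp: bij_betw_def\<close>)
  show ?thesis
  proof (cases "even L")
    case True
    then obtain m where m: "L = 2 * m" by (rule evenE)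
    have "m \<ge> 1" using m assms by simp
    \<comment> \<open>For even L there are two types of reflections: T, whose axis avoids all points
      and which represents even k, and RT, whose axis passes through 1 and m + 1 and which
      represents odd k.\<close>
    let ?g = "\<lambda>x. rotation L (reflection L x)"
    have T: "real (card {P\<in>NC L. ?T P = P}) = real ((2 * m) choose m)"
      unfolding fix_T unfolding m by (rule card_sym_no_axis_point) (rule reflection_eq)
    have "inj_on ?g {1..L}"
      using bij_betw_trans[OF reflection_bij rotation_bij, of L]
      by (simp add: bij_betw_def comp_def)
    then have "card {P\<in>NC L. act ?g P = P} = card {E\<in>NCE L. rel_invariant ?g E}"
      by (rule card_act_fixed[rotated]) (use D.T_closed D.R_closed act_act in metis)
    moreover have "real (card {E\<in>NCE (2 * m). rel_invariant ?g E}) = real ((2 * m) choose m)"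
    proof (rule card_sym_two_axis_points[OF \<open>m \<ge> 1\<close>])
      show "?g 1 = 1" using assms by (simp add: reflection_eq rotation_eq)
      show "?g x = 2 * m + 2 - x" if "x \<in> {2..2 * m}" for x
      proof -
        have "x \<in> {1..L}" "L + 1 - x \<in> {1..L}" "L + 1 - x \<noteq> L" using that m by auto
        then show ?thesis using m by (simp add: reflection_eq rotation_eq Suc_diff_le)
      qed
    qed
    ultimately have RT: "real (card {P\<in>NC L. ?R (?T P) = P}) = real ((2 * m) choose m)"
      by (simp add: act_act m)
    have "real (card {P\<in>NC L. (?R ^^ k) (?T P) = P}) = real ((2 * m) choose m)" for k
    proof (cases "even k")
      case True
      then obtain j where "k = 2 * j" by (rule evenE)
      then show ?thesis using T D.card_fixed_even by simp
    next
      case False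
      then obtain j where "k = 2 * j + 1" by (rule oddE)
      then show ?thesis using RT D.card_fixed_odd by simp
    qed
    from avg[OF this] show ?thesis using m by (simp add: N_Z_sqtri_FP_def)
  next
    case False
    then obtain n where n: "L = 2 * n + 1" by (rule oddE)
    define m where "m = n + 1"
    have m: "m \<ge> 1" "L = 2 * m - 1" "(L + 1) div 2 = m" using n by (simp_all add: m_def)
    have T: "real (card {P\<in>NC L. ?T P = P}) = real ((2 * m) choose m) / 2"
      unfolding fix_T unfolding m(2)
    proof (rule card_sym_one_axis_point[OF m(1)])
      show "reflection (2 * m - 1) x = 2 * m - x" if "x \<in> {1..2 * m - 1}" for x
        using reflection_eq[OF that] m(1) by simp
    qed
    have "real (card {P\<in>NC L. (?R ^^ k) (?T P) = P}) = real ((2 * m) choose m) / 2" for k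
    proof -
      \<comment> \<open>For odd L an odd exponent k can be replaced by the even exponent k + L,
        because R^L is the identity. Every reflection thus has as many fixed partitions as
        T.\<close>
      obtain j where j: "(?R ^^ k) (?T P) = (?R ^^ (2 * j)) (?T P)" if "P \<in> NC L" for P
      proof (cases "even k")
        case True
        then obtain j where "k = 2 * j" by (rule evenE)
        then show thesis using that by blast
      next
        case odd: False
        then have "even (k + L)" using False by simp
        then obtain j where j: "k + L = 2 * j" by (rule evenE)
        have "(?R ^^ k) (?T P) = (?R ^^ (2 * j)) (?T P)" if "P \<in> NC L" for P
        proof -
          have "(?R ^^ (2 * j)) (?T P) = (?R ^^ k) ((?R ^^ L) (?T P))"
            unfolding j[symmetric] by (simp only: D.Rpow_Rpow)
          then show ?thesis by (simp only: D.R_period[OF D.T_closed[OF that]])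
        qed
        then show thesis using that by blast
      qed
      have "{P\<in>NC L. (?R ^^ k) (?T P) = P} = {P\<in>NC L. (?R ^^ (2 * j)) (?T P) = P}"
        using j by auto
      then show ?thesis using T D.card_fixed_even by simp
    qed
    from avg[OF this] show ?thesis using False m(3) by (simp add: N_Z_sqtri_FP_def)
  qed
qed

end
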